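(* Let $p \ge 1$ be an integer. Let $\mu_1,\ldots,\mu_p$ be fixed centered probability laws on $\mathbb{R}$ with unit variance and a finite fourth moment. For all integers $n_0,\ldots,n_p \ge 1$, let $A^{(1)} \in \mathbb{R}^{n_0\times n_1}, \ldots, A^{(p)} \in \mathbb{R}^{n_{p-1}\times n_p}$ be independent random matrices such that, for each $q$, the entries of $A^{(q)}$ are i.i.d. with law $\mu_q$, and let $P := A^{(1)} \cdots A^{(p)} \in \mathbb{R}^{n_0 \times n_p}$. Let $m \ge 1$ be an arbitrary integer (the quantity below does not depend on $m$). Then $$m^{-1} (2 n_1 \cdots n_{p} \log n_0)^{-\frac 1 2} \|P\,\mathbf{1}_{n_p,m}\|_{\ell^\infty \to \ell^\infty} \xrightarrow[n_0 \asymp \cdots \asymp n_{p} \to \infty]{\text{(prob.)}} 1.$$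
   Context: $\mathbf{1}_{m,n}$ denotes the $m$-by-$n$ matrix with all entries equal to $1$. For a matrix $A = (A_{ij}) \in \mathbb{R}^{m\times n}$, $\|A\|_{\ell^\infty \to \ell^\infty} := \sup_{|x|_\infty \le 1} |Ax|_\infty = \max_{1 \le i \le m} \sum_{j = 1}^n |A_{ij}|$, where $|x|_\infty=\max_j|x_j|$. For random variables $U(n_0,\ldots,n_p)$ and $X$, the notation $U(n_0,\ldots, n_p) \xrightarrow[n_0 \asymp \cdots \asymp n_p \to \infty]{\text{(prob.)}} X$ means: for every $C < +\infty$ and $\varepsilon,\delta > 0$, there exists $N \in \mathbb{N}$ such that if $N \le n_q \le C n_{q'}$ for all $q,q' \in \{0,\ldots, p\}$, then $\mathbb{P}[|U(n_0,\ldots,n_p) - X| \ge \varepsilon] \le \delta$. *)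

theory Defs
  imports "HOL-Probability.Probability" "Jordan_Normal_Form.Matrix"
begin

text \<open>
  Matrices have type \<^typ>\<open>real mat\<close> (rows and columns indexed from 0), because the dimensions
  vary inside the statement.
\<close>

(* Meaningful only for positive dimension: Max of the empty set is unspecified. *)
definition sup_norm_vec :: "real vec \<Rightarrow> real" where
  "sup_norm_vec x = Max ((\<lambda>j. \<bar>vec_index x j\<bar>) ` {..<dim_vec x})"

definition linf_op_norm :: "real mat \<Rightarrow> real" where
  "linf_op_norm A =
     (SUP x\<in>{x \<in> carrier_vec (dim_col A). sup_norm_vec x \<le> 1}. sup_norm_vec (A *\<^sub>v x))"

lemma linf_op_norm_eq_Max_row_sum:
  assumes A: "A \<in> carrier_mat m n" and m: "m \<ge> 1" and n: "n \<ge> 1"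
  shows "linf_op_norm A = Max ((\<lambda>i. \<Sum>j<n. \<bar>A $$ (i, j)\<bar>) ` {..<m})" (is "_ = ?R")
proof -
  let ?S = "{x \<in> carrier_vec n. sup_norm_vec x \<le> 1}"
  have dims: "dim_row A = m" "dim_col A = n" using A by auto
  have mv: "vec_index (A *\<^sub>v x) i = (\<Sum>j<n. A $$ (i, j) * vec_index x j)"
    if "x \<in> carrier_vec n" "i < m" for x i
    using that dims by (auto simp: scalar_prod_def lessThan_atLeast0 intro!: sum.cong)
  have S_iff: "x \<in> ?S \<longleftrightarrow> x \<in> carrier_vec n \<and> (\<forall>j<n. \<bar>vec_index x j\<bar> \<le> 1)" for x
  proof (cases "x \<in> carrier_vec n")
    case True
    then have d: "dim_vec x = n" by auto
    have "{..<n} \<noteq> {}" using n by (auto simp: lessThan_empty_iff)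
    then show ?thesis using True d by (auto simp: sup_norm_vec_def)
  qed auto
  have ne: "{..<m} \<noteq> {}" using m by (auto simp: lessThan_empty_iff)
  have norm_Av: "sup_norm_vec (A *\<^sub>v x) = Max ((\<lambda>i. \<bar>vec_index (A *\<^sub>v x) i\<bar>) ` {..<m})" for x
    using dims by (simp add: sup_norm_vec_def)
  have ub: "sup_norm_vec (A *\<^sub>v x) \<le> ?R" if x: "x \<in> ?S" for x
  proof -
    have xc: "x \<in> carrier_vec n" and x1: "\<And>j. j < n \<Longrightarrow> \<bar>vec_index x j\<bar> \<le> 1"
      using x unfolding S_iff by auto
    have "\<bar>vec_index (A *\<^sub>v x) i\<bar> \<le> ?R" if i: "i < m" for i
    proof -
      have "\<bar>vec_index (A *\<^sub>v x) i\<bar> \<le> (\<Sum>j<n. \<bar>A $$ (i, j) * vec_index x j\<bar>)"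
        unfolding mv[OF xc i] by (rule sum_abs)
      also have "\<dots> \<le> (\<Sum>j<n. \<bar>A $$ (i, j)\<bar>)"
        by (rule sum_mono) (auto simp: abs_mult intro!: mult_left_le x1)
      also have "\<dots> \<le> ?R" using i by (intro Max_ge) auto
      finally show ?thesis .
    qed
    then show ?thesis unfolding norm_Av using ne by (subst Max_le_iff) auto
  qed
  have "?R \<in> (\<lambda>i. \<Sum>j<n. \<bar>A $$ (i, j)\<bar>) ` {..<m}" using ne by (intro Max_in) auto
  then obtain i where i: "i < m" and Ri: "?R = (\<Sum>j<n. \<bar>A $$ (i, j)\<bar>)" by auto
  define y where "y = vec n (\<lambda>j. sgn (A $$ (i, j)))"
  have y: "y \<in> ?S" unfolding S_iff by (auto simp: y_def abs_sgn_eq)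
  have "vec_index (A *\<^sub>v y) i = ?R"
    unfolding Ri by (subst mv) (use i in \<open>auto simp: y_def abs_sgn intro!: sum.cong\<close>)
  then have "?R \<le> \<bar>vec_index (A *\<^sub>v y) i\<bar>" by simp
  also have "\<dots> \<le> sup_norm_vec (A *\<^sub>v y)"
    unfolding norm_Av using i by (intro Max_ge) auto
  finally have "sup_norm_vec (A *\<^sub>v y) = ?R" using ub[OF y] by simp
  then have "(SUP x\<in>?S. sup_norm_vec (A *\<^sub>v x)) = ?R"
    by (intro cSup_eq_maximum) (use y ub in \<open>auto intro!: rev_image_eqI[of y]\<close>)
  then show ?thesis by (simp add: linf_op_norm_def dims)
qed

definition ones_mat :: "nat \<Rightarrow> nat \<Rightarrow> real mat" where
  "ones_mat r c = mat r c (\<lambda>_. 1)"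

(* B 1 * ... * B p, where d is the number of rows of B 1. *)
primrec mat_prod :: "nat \<Rightarrow> (nat \<Rightarrow> real mat) \<Rightarrow> nat \<Rightarrow> real mat" where
  "mat_prod d B 0 = 1\<^sub>m d"
| "mat_prod d B (Suc q) = mat_prod d B q * B (Suc q)"

definition iid_random_mat ::
    "'a measure \<Rightarrow> real measure \<Rightarrow> nat \<Rightarrow> nat \<Rightarrow> ('a \<Rightarrow> real mat) \<Rightarrow> bool" where
  "iid_random_mat M \<nu> r c A \<longleftrightarrow>
     (\<forall>\<omega>\<in>space M. A \<omega> \<in> carrier_mat r c) \<and>
     prob_space.indep_vars M (\<lambda>_. borel) (\<lambda>ij \<omega>. A \<omega> $$ ij) ({..<r} \<times> {..<c}) \<and>
     (\<forall>ij\<in>{..<r} \<times> {..<c}. distr M borel (\<lambda>\<omega>. A \<omega> $$ ij) = \<nu>)"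

(* Matrices are identified with their families of entries; the sigma-algebra is the product one. *)
definition indep_random_mats ::
    "'a measure \<Rightarrow> (nat \<Rightarrow> nat) \<Rightarrow> (nat \<Rightarrow> nat) \<Rightarrow> nat set \<Rightarrow> (nat \<Rightarrow> 'a \<Rightarrow> real mat) \<Rightarrow> bool" where
  "indep_random_mats M r c Q A \<longleftrightarrow>
     prob_space.indep_vars M
       (\<lambda>q. \<Pi>\<^sub>M ij\<in>{..<r q} \<times> {..<c q}. borel)
       (\<lambda>q \<omega>. \<lambda>ij\<in>{..<r q} \<times> {..<c q}. A q \<omega> $$ ij) Q"

text \<open>
  Tuples \<open>(n\<^sub>0, \<dots>, n\<^sub>p)\<close> of positive integers. Using extensional functions means that there is
  exactly one function per tuple, so families indexed by this set are families indexed by tuples.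
\<close>

definition dim_tuples :: "nat \<Rightarrow> (nat \<Rightarrow> nat) set" where
  "dim_tuples p = {0..p} \<rightarrow>\<^sub>E {1..}"

text \<open>
  Convergence in probability as \<open>n\<^sub>0 \<asymp> \<cdots> \<asymp> n\<^sub>p \<rightarrow> \<infinity>\<close>. The probability space is allowed
  to depend on the tuple.
\<close>

definition tendsto_in_prob_asymp ::
    "nat \<Rightarrow> ((nat \<Rightarrow> nat) \<Rightarrow> 'a measure) \<Rightarrow> ((nat \<Rightarrow> nat) \<Rightarrow> 'a \<Rightarrow> real) \<Rightarrow> ('a \<Rightarrow> real) \<Rightarrow> bool" where
  "tendsto_in_prob_asymp p M U X \<longleftrightarrow>
     (\<forall>(C::real) \<epsilon> \<delta>. \<epsilon> > 0 \<longrightarrow> \<delta> > 0 \<longrightarrow>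
        (\<exists>N::nat. \<forall>n\<in>dim_tuples p.
           (\<forall>q\<in>{0..p}. \<forall>q'\<in>{0..p}. N \<le> n q \<and> real (n q) \<le> C * real (n q')) \<longrightarrow>
           measure (M n) {\<omega> \<in> space (M n). \<bar>U n \<omega> - X \<omega>\<bar> \<ge> \<epsilon>} \<le> \<delta>))"

definition normalized_ones_norm :: "nat \<Rightarrow> (nat \<Rightarrow> nat) \<Rightarrow> nat \<Rightarrow> (nat \<Rightarrow> real mat) \<Rightarrow> real" where
  "normalized_ones_norm p n m B =
     inverse (real m) * (2 * (\<Prod>q=1..p. real (n q)) * ln (real (n 0))) powr (- 1 / 2) *
     linf_op_norm (mat_prod (n 0) B p * ones_mat (n p) m)"

end

theory Submission
  imports Defs "HOL-Real_Asymp.Real_Asymp"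
begin

text \<open>
  Every column of \<open>P * 1\<close> equals \<open>A 1 * v\<close> with \<open>v = A 2 * \<dots> * A p * 1\<close>, and \<open>v\<close> is independent of
  \<open>A 1\<close>. Multiplying by one factor at a time, Chebyshev's inequality gives that the squared Euclidean norm of
  \<open>v\<close> is close to \<open>n 1 * \<dots> * n p\<close> with high probability, and Markov's inequality that its mass is spread
  out, in the sense that the sum of the fourth powers of its entries is \<open>O((n 1 * \<dots> * n p)\<^sup>2 / n 1)\<close>.

  For such a fixed \<open>v\<close>, normalized to a unit vector \<open>w\<close>, the entries of \<open>A 1 * w\<close> are \<open>n 0\<close> independent sums
  whose largest absolute value must be shown to be about \<open>L = sqrt (2 * ln (n 0))\<close>. With only four moments
  one truncates the summands at \<open>L / 16\<close>: by the fourth moment and \<open>n 0 = O(n 1)\<close>, with high probability no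
  summand of any row is affected, while the moment generating function of a truncated sum at \<open>l\<close> is
  \<open>exp (l\<^sup>2 / 2 + o(1))\<close> uniformly in \<open>\<bar>l\<bar> \<le> L\<close>. This yields the Gaussian upper tail by Chernoff's
  bound and a matching lower tail by exponential tilting, and the maximum over the independent rows follows.
\<close>

section \<open>Moments of independent sums\<close>

text \<open>In the Gaussian case one row sum reaches \<open>L\<close> with probability of order
  \<open>1 / n 0\<close> up to logarithmic factors. For comparable dimensions a Berry-Esseen error
  of order \<open>1 / sqrt (n 1)\<close> swamps this, and exponential moments of the entries need
  not exist; hence the truncation. Its level \<open>t\<close> must grow: the union bound over all
  entries costs \<open>n 0 * \<kappa> * (\<Sum>j. w j ^ 4) / t ^ 4\<close>, which is only
  \<open>O(1 / t ^ 4)\<close>. A small multiple of \<open>L\<close> makes this vanish while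
  \<open>exp (L * t)\<close> stays a small power of \<open>n 0\<close>.

  This is also why the sum of fourth powers is the quantity carried through the product: four
  moments suffice to control it, and its fourth root bounds the largest weight by a multiple of
  \<open>n 0 powr (- 1 / 4)\<close>, which makes the Taylor remainders negligible.

  The threshold for the dimensions may depend neither on the tuple nor on its probability space, nor
  on the value of the random vector on which one conditions. The estimates for a fixed vector are
  therefore uniform over all spaces, matrices and vectors.\<close>

lemma abs_power_le_one_plus_power4:
  fixes x :: real
  assumes "k \<le> 4"
  shows "\<bar>x\<bar> ^ k \<le> 1 + x ^ 4"
proof (cases "\<bar>x\<bar> \<le> 1")
  case True
  then have "\<bar>x\<bar> ^ k \<le> 1" by (intro power_le_one) auto
  moreover have "0 \<le> x ^ 4" by simp
  ultimately show ?thesis by linarith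
next
  case False
  then have "\<bar>x\<bar> ^ k \<le> \<bar>x\<bar> ^ 4" using assms by (intro power_increasing) auto
  then show ?thesis by (simp add: power_even_abs)
qed

context prob_space
begin

lemma integrable_power_of_power4:
  fixes X :: "'a \<Rightarrow> real"
  assumes [measurable]: "X \<in> borel_measurable M" and 4: "integrable M (\<lambda>\<omega>. X \<omega> ^ 4)" and k: "k \<le> 4"
  shows "integrable M (\<lambda>\<omega>. X \<omega> ^ k)"
proof (rule Bochner_Integration.integrable_bound[of _ "\<lambda>\<omega>. 1 + X \<omega> ^ 4"])
  show "integrable M (\<lambda>\<omega>. 1 + X \<omega> ^ 4)" using 4 by auto
  show "AE \<omega> in M. norm (X \<omega> ^ k) \<le> norm (1 + X \<omega> ^ 4)"
    using abs_power_le_one_plus_power4[OF k] by (auto simp: power_abs)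
qed simp

text \<open>By independence, every mixed term of the binomial expansion that contains
  \<open>S\<close> or \<open>Y\<close> to the first power has a factor of mean zero; only the square
  times the square, with coefficient 6, survives.\<close>

lemma fourth_moment_indep_add:
  fixes S Y :: "'a \<Rightarrow> real"
  assumes ind: "indep_var borel S borel Y"
    and S4: "integrable M (\<lambda>\<omega>. S \<omega> ^ 4)" and Y4: "integrable M (\<lambda>\<omega>. Y \<omega> ^ 4)"
    and S0: "expectation S = 0" and Y0: "expectation Y = 0"
  shows "integrable M (\<lambda>\<omega>. (S \<omega> + Y \<omega>) ^ 4)"
    and "expectation (\<lambda>\<omega>. S \<omega> + Y \<omega>) = 0"
    and "expectation (\<lambda>\<omega>. (S \<omega> + Y \<omega>)\<^sup>2) = expectation (\<lambda>\<omega>. (S \<omega>)\<^sup>2) + expectation (\<lambda>\<omega>. (Y \<omega>)\<^sup>2)"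
    and "expectation (\<lambda>\<omega>. (S \<omega> + Y \<omega>) ^ 4) = expectation (\<lambda>\<omega>. S \<omega> ^ 4)
       + 6 * (expectation (\<lambda>\<omega>. (S \<omega>)\<^sup>2) * expectation (\<lambda>\<omega>. (Y \<omega>)\<^sup>2)) + expectation (\<lambda>\<omega>. Y \<omega> ^ 4)"
proof -
  have [measurable]: "S \<in> borel_measurable M" "Y \<in> borel_measurable M"
    using indep_var_rv1[OF ind] indep_var_rv2[OF ind] by auto
  have iS: "integrable M (\<lambda>\<omega>. S \<omega> ^ k)" if "k \<le> 4" for k
    using integrable_power_of_power4[OF _ S4 that] by simp
  have iY: "integrable M (\<lambda>\<omega>. Y \<omega> ^ k)" if "k \<le> 4" for k
    using integrable_power_of_power4[OF _ Y4 that] by simp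
  have ind': "indep_var borel (\<lambda>\<omega>. S \<omega> ^ j) borel (\<lambda>\<omega>. Y \<omega> ^ k)" for j k
    using indep_var_compose[OF ind, of "\<lambda>x. x ^ j" borel "\<lambda>x. x ^ k" borel] by (simp add: comp_def)
  have iSY: "integrable M (\<lambda>\<omega>. S \<omega> ^ j * Y \<omega> ^ k)" if "j \<le> 4" "k \<le> 4" for j k
    using indep_var_integrable[OF ind' iS iY] that by auto
  have eSY: "expectation (\<lambda>\<omega>. S \<omega> ^ j * Y \<omega> ^ k) = expectation (\<lambda>\<omega>. S \<omega> ^ j) * expectation (\<lambda>\<omega>. Y \<omega> ^ k)"
    if "j \<le> 4" "k \<le> 4" for j k
    using indep_var_lebesgue_integral[OF ind' iS iY] that by auto
  have e4: "(S \<omega> + Y \<omega>) ^ 4 = S \<omega> ^ 4 + 4 * (S \<omega> ^ 3 * Y \<omega> ^ 1) + 6 * (S \<omega> ^ 2 * Y \<omega> ^ 2)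
     + 4 * (S \<omega> ^ 1 * Y \<omega> ^ 3) + Y \<omega> ^ 4" for \<omega>
    by (simp add: numeral_eq_Suc algebra_simps)
  have e2: "(S \<omega> + Y \<omega>)\<^sup>2 = S \<omega> ^ 2 + 2 * (S \<omega> ^ 1 * Y \<omega> ^ 1) + Y \<omega> ^ 2" for \<omega>
    by (simp add: numeral_eq_Suc algebra_simps)
  note ii = iSY[of 3 1] iSY[of 2 2] iSY[of 1 3] iSY[of 1 1] iS[of 2] iS[of 1] iY[of 2] iY[of 1] iS[of 4] iY[of 4]
  show "integrable M (\<lambda>\<omega>. (S \<omega> + Y \<omega>) ^ 4)"
    unfolding e4 using ii by auto
  show "expectation (\<lambda>\<omega>. S \<omega> + Y \<omega>) = 0"
    using ii S0 Y0 by simp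
  show "expectation (\<lambda>\<omega>. (S \<omega> + Y \<omega>)\<^sup>2) = expectation (\<lambda>\<omega>. (S \<omega>)\<^sup>2) + expectation (\<lambda>\<omega>. (Y \<omega>)\<^sup>2)"
    unfolding e2 using ii S0 Y0 eSY[of 1 1] by simp
  show "expectation (\<lambda>\<omega>. (S \<omega> + Y \<omega>) ^ 4) = expectation (\<lambda>\<omega>. S \<omega> ^ 4)
       + 6 * (expectation (\<lambda>\<omega>. (S \<omega>)\<^sup>2) * expectation (\<lambda>\<omega>. (Y \<omega>)\<^sup>2)) + expectation (\<lambda>\<omega>. Y \<omega> ^ 4)"
    unfolding e4 using ii S0 Y0 eSY[of 1 3] eSY[of 3 1] eSY[of 2 2] by simp
qed

text \<open>The cross term vanishes by independence and centering. Integrability and mean belong to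
  the claim because the induction step needs both for the partial sum.\<close>

lemma sum_second_moment_indep:
  fixes Z :: "'i \<Rightarrow> 'a \<Rightarrow> real"
  assumes "finite I" "indep_vars (\<lambda>_. borel) Z I"
    and "\<And>i. i \<in> I \<Longrightarrow> integrable M (\<lambda>\<omega>. (Z i \<omega>)\<^sup>2)"
    and "\<And>i. i \<in> I \<Longrightarrow> expectation (Z i) = 0"
  shows "integrable M (\<lambda>\<omega>. (\<Sum>i\<in>I. Z i \<omega>)\<^sup>2)
     \<and> expectation (\<lambda>\<omega>. \<Sum>i\<in>I. Z i \<omega>) = 0
     \<and> expectation (\<lambda>\<omega>. (\<Sum>i\<in>I. Z i \<omega>)\<^sup>2) = (\<Sum>i\<in>I. expectation (\<lambda>\<omega>. (Z i \<omega>)\<^sup>2))"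
  using assms
proof (induction I rule: finite_induct)
  case (insert i I)
  let ?S = "\<lambda>\<omega>. \<Sum>i\<in>I. Z i \<omega>"
  have meas[measurable]: "Z j \<in> borel_measurable M" if "j \<in> insert i I" for j
    using insert.prems(1) that by (auto simp: indep_vars_def)
  have Sm[measurable]: "?S \<in> borel_measurable M" by (intro borel_measurable_sum meas) auto
  have IH: "integrable M (\<lambda>\<omega>. (?S \<omega>)\<^sup>2)" "expectation ?S = 0"
    "expectation (\<lambda>\<omega>. (?S \<omega>)\<^sup>2) = (\<Sum>i\<in>I. expectation (\<lambda>\<omega>. (Z i \<omega>)\<^sup>2))"
    using insert.IH[OF indep_vars_subset[OF insert.prems(1)]] insert.prems by auto
  have Zi: "integrable M (\<lambda>\<omega>. (Z i \<omega>)\<^sup>2)" "expectation (Z i) = 0" using insert.prems by auto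
  have i1: "integrable M (Z i)" "integrable M ?S"
    using square_integrable_imp_integrable[OF meas Zi(1)] square_integrable_imp_integrable[OF Sm IH(1)] by auto
  have ind: "indep_var borel (Z i) borel ?S"
    using indep_vars_sum[OF insert.hyps insert.prems(1)] .
  have prod: "integrable M (\<lambda>\<omega>. Z i \<omega> * ?S \<omega>)" "expectation (\<lambda>\<omega>. Z i \<omega> * ?S \<omega>) = 0"
    using indep_var_integrable[OF ind i1] indep_var_lebesgue_integral[OF ind i1] Zi(2) by auto
  have eq: "(Z i \<omega> + ?S \<omega>)\<^sup>2 = (Z i \<omega>)\<^sup>2 + 2 * (Z i \<omega> * ?S \<omega>) + (?S \<omega>)\<^sup>2" for \<omega>
    by (simp add: numeral_eq_Suc algebra_simps)
  show ?case
    using insert.hyps IH Zi i1 prod by (simp add: eq)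
qed (simp add: prob_space)

end

section \<open>Moment generating functions of truncated sums\<close>

lemma exp_taylor2_error:
  fixes x :: real
  shows "\<bar>exp x - 1 - x - x\<^sup>2 / 2\<bar> \<le> \<bar>x\<bar> ^ 3 * exp \<bar>x\<bar>"
proof -
  obtain t where t: "\<bar>t\<bar> \<le> \<bar>x\<bar>" "exp x = (\<Sum>m<3. x ^ m / fact m) + exp t / fact 3 * x ^ 3"
    using Maclaurin_exp_le[of x 3] by blast
  have "exp x - 1 - x - x\<^sup>2 / 2 = exp t * x ^ 3 / 6"
    using t(2) by (simp add: numeral_eq_Suc fact_reduce)
  then have "\<bar>exp x - 1 - x - x\<^sup>2 / 2\<bar> = exp t * \<bar>x\<bar> ^ 3 / 6"
    by (simp only: abs_mult power_abs abs_divide) simp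
  also have "\<dots> \<le> exp t * \<bar>x\<bar> ^ 3" by simp
  also have "\<dots> \<le> exp \<bar>x\<bar> * \<bar>x\<bar> ^ 3" using t(1) by (intro mult_right_mono) auto
  finally show ?thesis by (simp add: mult.commute)
qed

text \<open>Exponentiated form of \<open>ln (1 + x) \<ge> x - x\<^sup>2 / 2\<close>. Together with
  its counterpart for \<open>1 - x\<close> it turns the factors of a product into exponentials, as
  the lower bound on a moment generating function requires.\<close>

lemma exp_le_one_plus:
  fixes x :: real
  assumes "0 \<le> x"
  shows "exp (x - x\<^sup>2 / 2) \<le> 1 + x"
proof -
  have "x - x\<^sup>2 / 2 \<le> ln (1 + x)"
  proof -
    have "x - x\<^sup>2 / 2 - ln (1 + x) \<le> 0 - 0\<^sup>2 / 2 - ln (1 + 0)"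
    proof (rule DERIV_nonpos_imp_nonincreasing[OF assms])
      fix y :: real assume y: "0 \<le> y" "y \<le> x"
      have "((\<lambda>x. x - x\<^sup>2 / 2 - ln (1 + x)) has_real_derivative (1 - y - 1 / (1 + y))) (at y)"
        using y by (auto intro!: derivative_eq_intros)
      moreover have "1 - y - 1 / (1 + y) \<le> 0" using y by (simp add: field_simps)
      ultimately show "\<exists>d. ((\<lambda>x. x - x\<^sup>2 / 2 - ln (1 + x)) has_real_derivative d) (at y) \<and> d \<le> 0"
        by blast
    qed
    then show ?thesis by simp
  qed
  then have "exp (x - x\<^sup>2 / 2) \<le> exp (ln (1 + x))" by simp
  then show ?thesis using assms by simp
qed

lemma exp_le_one_minus:
  fixes x :: real
  assumes "0 \<le> x" "x \<le> 1 / 2"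
  shows "exp (- (2 * x)) \<le> 1 - x"
proof -
  have "x * x \<le> x * (1 / 2)" using assms by (intro mult_left_mono) auto
  then have "- (2 * x) \<le> ln (1 - x)"
    using ln_one_minus_pos_lower_bound[OF assms] assms by (simp add: power2_eq_square)
  then have "exp (- (2 * x)) \<le> exp (ln (1 - x))" by simp
  then show ?thesis using assms by simp
qed

text \<open>Values beyond the threshold become 0 instead of being clipped, so that there
  \<open>exp (l * trunc c x) = 1\<close> and only the linear and quadratic terms remain to be
  estimated.\<close>

definition trunc :: "real \<Rightarrow> real \<Rightarrow> real" where
  "trunc c x = (if \<bar>x\<bar> \<le> c then x else 0)"

lemma trunc_measurable [measurable]: "trunc c \<in> borel_measurable borel"
  unfolding trunc_def by measurable

lemma abs_trunc_le: "0 \<le> c \<Longrightarrow> \<bar>trunc c x\<bar> \<le> c"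
  by (simp add: trunc_def)

text \<open>
  The three summands account for the mean and the second moment lost by truncation and for the
  third-order Taylor remainder.
\<close>
definition trunc_err :: "real \<Rightarrow> real \<Rightarrow> real \<Rightarrow> real \<Rightarrow> real" where
  "trunc_err \<kappa> L c b =
     L * \<kappa> * b\<^sup>2 / c ^ 3 + L\<^sup>2 * \<kappa> * b\<^sup>2 / (2 * c\<^sup>2) + L ^ 3 * b * (1 + \<kappa>) * exp (L * c)"

text \<open>The expansion is around the untruncated variable, so that its exact mean and variance
  can be inserted later. Below the threshold this is the Taylor remainder, with
  \<open>\<bar>x\<bar> ^ 3 \<le> x\<^sup>2 + x ^ 4\<close> to avoid a third absolute moment. Above
  it, \<open>c < \<bar>y\<bar>\<close> trades the missing powers of \<open>y\<close> for a fourth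
  power.\<close>

lemma exp_trunc_error:
  fixes x :: real
  assumes l: "\<bar>l\<bar> \<le> L" and c: "0 < c"
  shows "\<bar>exp (l * trunc c (x * w)) - 1 - l * (x * w) - l\<^sup>2 * (x * w)\<^sup>2 / 2\<bar>
     \<le> L / c ^ 3 * (x * w) ^ 4 + L\<^sup>2 / (2 * c\<^sup>2) * (x * w) ^ 4
        + L ^ 3 * exp (L * c) * \<bar>w\<bar> ^ 3 * (x\<^sup>2 + x ^ 4)"
proof -
  define y where "y = x * w"
  have L: "0 \<le> L" using l by linarith
  have p: "0 \<le> L / c ^ 3 * y ^ 4" "0 \<le> L\<^sup>2 / (2 * c\<^sup>2) * y ^ 4"
    "0 \<le> L ^ 3 * exp (L * c) * \<bar>w\<bar> ^ 3 * (x\<^sup>2 + x ^ 4)"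
    using L c by auto
  have l2: "l\<^sup>2 \<le> L\<^sup>2" using power_mono[OF l, of 2] by simp
  have "\<bar>exp (l * trunc c y) - 1 - l * y - l\<^sup>2 * y\<^sup>2 / 2\<bar>
     \<le> L / c ^ 3 * y ^ 4 + L\<^sup>2 / (2 * c\<^sup>2) * y ^ 4 + L ^ 3 * exp (L * c) * \<bar>w\<bar> ^ 3 * (x\<^sup>2 + x ^ 4)"
  proof (cases "\<bar>y\<bar> \<le> c")
    case True
    have "\<bar>exp (l * trunc c y) - 1 - l * y - l\<^sup>2 * y\<^sup>2 / 2\<bar> \<le> \<bar>l * y\<bar> ^ 3 * exp \<bar>l * y\<bar>"
      using exp_taylor2_error[of "l * y"] True by (simp add: trunc_def power_mult_distrib)
    also have "\<dots> \<le> (L * \<bar>y\<bar>) ^ 3 * exp (L * c)"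
      using l True c by (intro mult_mono power_mono) (auto simp: abs_mult intro!: mult_mono)
    also have "\<dots> = L ^ 3 * exp (L * c) * \<bar>w\<bar> ^ 3 * \<bar>x\<bar> ^ 3"
      by (simp add: y_def abs_mult power_mult_distrib)
    also have "\<dots> \<le> L ^ 3 * exp (L * c) * \<bar>w\<bar> ^ 3 * (x\<^sup>2 + x ^ 4)"
    proof (rule mult_left_mono)
      have "\<bar>x\<bar> * x\<^sup>2 \<le> (1 + \<bar>x\<bar>\<^sup>2) * x\<^sup>2"
      proof (rule mult_right_mono)
        show "\<bar>x\<bar> \<le> 1 + \<bar>x\<bar>\<^sup>2"
          using sum_squares_bound[of "\<bar>x\<bar>" 1] by simp
      qed simp
      then show "\<bar>x\<bar> ^ 3 \<le> x\<^sup>2 + x ^ 4"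
        by (simp add: algebra_simps numeral_eq_Suc)
    qed (use L in auto)
    finally show ?thesis using p by linarith
  next
    case False
    then have yc: "c < \<bar>y\<bar>" by simp
    have a: "c ^ 3 * \<bar>y\<bar> \<le> y ^ 4"
    proof -
      have "c ^ 3 * \<bar>y\<bar> \<le> \<bar>y\<bar> ^ 3 * \<bar>y\<bar>" using yc c by (intro mult_right_mono power_mono) auto
      then show ?thesis by (simp add: power_even_abs flip: power_Suc2)
    qed
    have b: "c\<^sup>2 * y\<^sup>2 \<le> y ^ 4"
    proof -
      have "c\<^sup>2 * y\<^sup>2 \<le> \<bar>y\<bar>\<^sup>2 * y\<^sup>2" using yc c by (intro mult_right_mono power_mono) auto
      then show ?thesis by (simp flip: power_add)
    qed
    have "\<bar>exp (l * trunc c y) - 1 - l * y - l\<^sup>2 * y\<^sup>2 / 2\<bar> \<le> \<bar>l * y\<bar> + \<bar>l\<^sup>2 * y\<^sup>2 / 2\<bar>"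
      using False abs_triangle_ineq4[of "- (l * y)" "l\<^sup>2 * y\<^sup>2 / 2"] by (simp add: trunc_def)
    also have "\<dots> = \<bar>l\<bar> * \<bar>y\<bar> + l\<^sup>2 * y\<^sup>2 / 2"
      by (simp add: abs_mult)
    also have "\<dots> \<le> L * \<bar>y\<bar> + L\<^sup>2 * y\<^sup>2 / 2"
      using l l2 by (intro add_mono divide_right_mono mult_right_mono) auto
    also have "\<dots> \<le> L * (y ^ 4 / c ^ 3) + L\<^sup>2 * (y ^ 4 / c\<^sup>2) / 2"
      using a b L c by (intro add_mono divide_right_mono mult_left_mono) (auto simp: field_simps)
    finally show ?thesis using p by (simp add: field_simps)
  qed
  then show ?thesis by (simp add: y_def)
qed

context prob_space
begin

text \<open>All error terms are brought to multiples of \<open>w\<^sup>2\<close> by giving up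
  surplus powers of \<open>w\<close> to \<open>b\<close>. Errors of this shape add up to a single
  \<open>trunc_err\<close> when the squared weights sum to 1.\<close>

lemma trunc_mgf_error:
  fixes X :: "'a \<Rightarrow> real"
  assumes [measurable]: "X \<in> borel_measurable M" and X4: "integrable M (\<lambda>\<omega>. X \<omega> ^ 4)"
    and X0: "expectation X = 0" and X2: "expectation (\<lambda>\<omega>. (X \<omega>)\<^sup>2) = 1"
    and \<kappa>: "expectation (\<lambda>\<omega>. X \<omega> ^ 4) \<le> \<kappa>"
    and w: "\<bar>w\<bar> \<le> b" and c: "0 < c" and l: "\<bar>l\<bar> \<le> L"
  shows "\<bar>expectation (\<lambda>\<omega>. exp (l * trunc c (X \<omega> * w))) - (1 + l\<^sup>2 * w\<^sup>2 / 2)\<bar> \<le> trunc_err \<kappa> L c b * w\<^sup>2"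
    and "integrable M (\<lambda>\<omega>. exp (l * trunc c (X \<omega> * w)))"
proof -
  have L: "0 \<le> L" and b: "0 \<le> b" using l w by linarith+
  let ?E = "\<lambda>\<omega>. exp (l * trunc c (X \<omega> * w))"
  have le: "\<bar>l * trunc c x\<bar> \<le> L * c" for x
    unfolding abs_mult using l c abs_trunc_le[of c x] by (intro mult_mono) auto
  show iE: "integrable M ?E"
  proof (rule integrable_const_bound[of _ "exp (L * c)"])
    show "AE \<omega> in M. norm (?E \<omega>) \<le> exp (L * c)"
      using le by (auto simp: abs_le_iff)
  qed measurable
  have i: "integrable M X" "integrable M (\<lambda>\<omega>. (X \<omega>)\<^sup>2)"
    using integrable_power_of_power4[OF _ X4, of 1] integrable_power_of_power4[OF _ X4, of 2] by auto
  let ?D = "\<lambda>\<omega>. L / c ^ 3 * (X \<omega> * w) ^ 4 + L\<^sup>2 / (2 * c\<^sup>2) * (X \<omega> * w) ^ 4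
        + L ^ 3 * exp (L * c) * \<bar>w\<bar> ^ 3 * ((X \<omega>)\<^sup>2 + X \<omega> ^ 4)"
  let ?F = "\<lambda>\<omega>. ?E \<omega> - 1 - l * (X \<omega> * w) - l\<^sup>2 * (X \<omega> * w)\<^sup>2 / 2"
  have iD: "integrable M ?D" using i X4 by (simp add: power_mult_distrib)
  have iF: "integrable M ?F" using i iE by (simp add: power_mult_distrib)
  have "expectation ?F = expectation ?E - (1 + l\<^sup>2 * w\<^sup>2 / 2)"
    using i iE X0 X2 by (simp add: power_mult_distrib prob_space)
  moreover have "\<bar>expectation ?F\<bar> \<le> expectation ?D"
  proof -
    have "\<bar>expectation ?F\<bar> \<le> expectation (\<lambda>\<omega>. \<bar>?F \<omega>\<bar>)" by (rule integral_abs_bound)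
    also have "\<dots> \<le> expectation ?D"
      by (intro integral_mono integrable_abs iF iD exp_trunc_error[OF l c])
    finally show ?thesis .
  qed
  moreover have "expectation ?D \<le> trunc_err \<kappa> L c b * w\<^sup>2"
  proof -
    let ?k = "expectation (\<lambda>\<omega>. X \<omega> ^ 4)"
    have k0: "0 \<le> ?k" by (intro integral_nonneg_AE) auto
    have w2: "w\<^sup>2 \<le> b\<^sup>2" using power_mono[OF w, of 2] by simp
    have w4: "w ^ 4 \<le> b\<^sup>2 * w\<^sup>2"
    proof -
      have "w\<^sup>2 * w\<^sup>2 \<le> b\<^sup>2 * w\<^sup>2" using w2 by (intro mult_right_mono) auto
      then show ?thesis by (simp flip: power_add)
    qed
    have w3: "\<bar>w\<bar> ^ 3 \<le> b * w\<^sup>2"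
    proof -
      have "\<bar>w\<bar> * \<bar>w\<bar>\<^sup>2 \<le> b * \<bar>w\<bar>\<^sup>2" using w by (intro mult_right_mono) auto
      then show ?thesis by (simp add: numeral_eq_Suc)
    qed
    have wk: "?k * w ^ 4 \<le> \<kappa> * (b\<^sup>2 * w\<^sup>2)"
      using w4 \<kappa> k0 order_trans[OF k0 \<kappa>] by (intro mult_mono) auto
    have wk3: "\<bar>w\<bar> ^ 3 * (1 + ?k) \<le> (b * w\<^sup>2) * (1 + \<kappa>)"
      using w3 \<kappa> k0 b by (intro mult_mono) auto
    have "expectation ?D = L / c ^ 3 * (?k * w ^ 4) + L\<^sup>2 / (2 * c\<^sup>2) * (?k * w ^ 4)
        + L ^ 3 * exp (L * c) * (\<bar>w\<bar> ^ 3 * (1 + ?k))"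
      using i X4 X2 by (simp add: power_mult_distrib algebra_simps)
    also have "\<dots> \<le> L / c ^ 3 * (\<kappa> * (b\<^sup>2 * w\<^sup>2)) + L\<^sup>2 / (2 * c\<^sup>2) * (\<kappa> * (b\<^sup>2 * w\<^sup>2))
        + L ^ 3 * exp (L * c) * ((b * w\<^sup>2) * (1 + \<kappa>))"
      using wk wk3 L c by (intro add_mono mult_left_mono) auto
    also have "\<dots> = trunc_err \<kappa> L c b * w\<^sup>2"
      by (simp add: trunc_err_def algebra_simps)
    finally show ?thesis .
  qed
  ultimately show "\<bar>expectation ?E - (1 + l\<^sup>2 * w\<^sup>2 / 2)\<bar> \<le> trunc_err \<kappa> L c b * w\<^sup>2"
    by simp
qed

text \<open>By independence the moment generating function is a product of factors
  \<open>1 + l\<^sup>2 * (w j)\<^sup>2 / 2\<close>, each up to an error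
  \<open>trunc_err \<kappa> L c b * (w j)\<^sup>2\<close>. Upwards, \<open>1 + x \<le> exp x\<close>
  is enough. Downwards, the losses \<open>x\<^sup>2 / 2\<close> with
  \<open>x = l\<^sup>2 * (w j)\<^sup>2 / 2\<close> add up to at most
  \<open>L ^ 4 * b\<^sup>2 / 8\<close>, and a subtracted error \<open>y\<close> becomes a factor
  \<open>exp (- 2 * y)\<close>, whence the doubling and the bound 1/2 on the error.\<close>

lemma trunc_sum_mgf:
  fixes X :: "'i \<Rightarrow> 'a \<Rightarrow> real" and w :: "'i \<Rightarrow> real"
  assumes J: "finite J" and ind: "indep_vars (\<lambda>_. borel) X J"
    and X4: "\<And>j. j \<in> J \<Longrightarrow> integrable M (\<lambda>\<omega>. X j \<omega> ^ 4)"
    and X0: "\<And>j. j \<in> J \<Longrightarrow> expectation (X j) = 0"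
    and X2: "\<And>j. j \<in> J \<Longrightarrow> expectation (\<lambda>\<omega>. (X j \<omega>)\<^sup>2) = 1"
    and \<kappa>: "\<And>j. j \<in> J \<Longrightarrow> expectation (\<lambda>\<omega>. X j \<omega> ^ 4) \<le> \<kappa>"
    and w: "\<And>j. j \<in> J \<Longrightarrow> \<bar>w j\<bar> \<le> b" and w2: "(\<Sum>j\<in>J. (w j)\<^sup>2) = 1"
    and c: "0 < c" and l: "\<bar>l\<bar> \<le> L"
    and b: "b \<le> 1" and err: "trunc_err \<kappa> L c b \<le> 1 / 2"
  defines "T \<equiv> (\<lambda>\<omega>. \<Sum>j\<in>J. trunc c (X j \<omega> * w j))"
  shows "integrable M (\<lambda>\<omega>. exp (l * T \<omega>))"
    and "expectation (\<lambda>\<omega>. exp (l * T \<omega>)) \<le> exp (l\<^sup>2 / 2 + (2 * trunc_err \<kappa> L c b + L ^ 4 * b\<^sup>2 / 8))"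
    and "exp (l\<^sup>2 / 2 - (2 * trunc_err \<kappa> L c b + L ^ 4 * b\<^sup>2 / 8)) \<le> expectation (\<lambda>\<omega>. exp (l * T \<omega>))"
proof -
  let ?e = "trunc_err \<kappa> L c b"
  let ?E = "\<lambda>j \<omega>. exp (l * trunc c (X j \<omega> * w j))"
  have Xm: "X j \<in> borel_measurable M" if "j \<in> J" for j
    using ind that by (auto simp: indep_vars_def)
  have ex: "\<bar>expectation (?E j) - (1 + l\<^sup>2 * (w j)\<^sup>2 / 2)\<bar> \<le> ?e * (w j)\<^sup>2" and iE: "integrable M (?E j)"
    if "j \<in> J" for j
    using trunc_mgf_error[OF Xm X4 X0 X2 \<kappa> w c l] that by auto
  have indE: "indep_vars (\<lambda>_. borel) ?E J"
    by (rule indep_vars_compose2[OF ind]) measurable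
  have eq: "exp (l * T \<omega>) = (\<Prod>j\<in>J. ?E j \<omega>)" for \<omega>
    unfolding T_def by (simp add: sum_distrib_left exp_sum J)
  show "integrable M (\<lambda>\<omega>. exp (l * T \<omega>))"
    unfolding eq by (rule indep_vars_integrable[OF J indE iE])
  have EP: "expectation (\<lambda>\<omega>. exp (l * T \<omega>)) = (\<Prod>j\<in>J. expectation (?E j))"
    unfolding eq by (rule indep_vars_lebesgue_integral[OF J indE iE])
  \<comment> \<open>The squared weights sum to 1, so \<open>J\<close> is nonempty; any member yields
    the signs of \<open>b\<close> and \<open>\<kappa>\<close>.\<close>
  obtain j0 where j0: "j0 \<in> J" using w2 by (metis sum.empty ex_in_conv zero_neq_one)
  have b0: "0 \<le> b" using w[OF j0] by linarith
  have L0: "0 \<le> L" using l by linarith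
  have k0: "0 \<le> \<kappa>"
    using \<kappa>[OF j0] by (rule order_trans[rotated]) (auto intro!: integral_nonneg_AE)
  have e0: "0 \<le> ?e" unfolding trunc_err_def using b0 L0 k0 c by auto
  have "expectation (\<lambda>\<omega>. exp (l * T \<omega>)) \<le> (\<Prod>j\<in>J. exp (l\<^sup>2 * (w j)\<^sup>2 / 2 + ?e * (w j)\<^sup>2))"
    unfolding EP
  proof (intro prod_mono conjI)
    fix j assume j: "j \<in> J"
    have "expectation (?E j) \<le> 1 + (l\<^sup>2 * (w j)\<^sup>2 / 2 + ?e * (w j)\<^sup>2)"
      using ex[OF j] by linarith
    also have "\<dots> \<le> exp (l\<^sup>2 * (w j)\<^sup>2 / 2 + ?e * (w j)\<^sup>2)" by (rule exp_ge_add_one_self)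
    finally show "expectation (?E j) \<le> exp (l\<^sup>2 * (w j)\<^sup>2 / 2 + ?e * (w j)\<^sup>2)" .
    show "0 \<le> expectation (?E j)" by (intro integral_nonneg_AE) auto
  qed
  also have "\<dots> = exp (\<Sum>j\<in>J. (l\<^sup>2 / 2 + ?e) * (w j)\<^sup>2)"
    by (simp add: exp_sum J algebra_simps)
  also have "\<dots> = exp (l\<^sup>2 / 2 + ?e)"
    by (simp add: w2 flip: sum_distrib_left)
  also have "\<dots> \<le> exp (l\<^sup>2 / 2 + (2 * ?e + L ^ 4 * b\<^sup>2 / 8))" using e0 by simp
  finally show "expectation (\<lambda>\<omega>. exp (l * T \<omega>)) \<le> exp (l\<^sup>2 / 2 + (2 * ?e + L ^ 4 * b\<^sup>2 / 8))" .
  have "exp (l\<^sup>2 / 2 - (2 * ?e + L ^ 4 * b\<^sup>2 / 8))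
      = exp (\<Sum>j\<in>J. l\<^sup>2 * (w j)\<^sup>2 / 2 - L ^ 4 * b\<^sup>2 / 8 * (w j)\<^sup>2 - 2 * (?e * (w j)\<^sup>2))"
    by (simp add: sum_subtractf w2 flip: sum_distrib_left sum_divide_distrib sum_distrib_right)
  also have "\<dots> \<le> exp (\<Sum>j\<in>J. (l\<^sup>2 * (w j)\<^sup>2 / 2 - (l\<^sup>2 * (w j)\<^sup>2 / 2)\<^sup>2 / 2) + - (2 * (?e * (w j)\<^sup>2)))"
  proof -
    have "(l\<^sup>2 * (w j)\<^sup>2 / 2)\<^sup>2 / 2 \<le> L ^ 4 * b\<^sup>2 / 8 * (w j)\<^sup>2" if "j \<in> J" for j
    proof -
      have "l ^ 4 * ((w j)\<^sup>2 * (w j)\<^sup>2) \<le> L ^ 4 * (b\<^sup>2 * (w j)\<^sup>2)"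
        using power_mono[OF l, of 4] power_mono[OF w[OF that], of 2] L0
        by (intro mult_mono) (auto simp: power_even_abs)
      then show ?thesis by (simp add: power_mult_distrib power_divide power2_eq_square power4_eq_xxxx algebra_simps)
    qed
    then show ?thesis by (subst exp_le_cancel_iff, intro sum_mono) (simp add: algebra_simps)
  qed
  also have "\<dots> = (\<Prod>j\<in>J. exp (l\<^sup>2 * (w j)\<^sup>2 / 2 - (l\<^sup>2 * (w j)\<^sup>2 / 2)\<^sup>2 / 2) * exp (- (2 * (?e * (w j)\<^sup>2))))"
    by (simp only: exp_sum[OF J] exp_add)
  also have "\<dots> \<le> (\<Prod>j\<in>J. expectation (?E j))"
  proof (intro prod_mono conjI)
    fix j assume j: "j \<in> J"
    have wj: "(w j)\<^sup>2 \<le> 1"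
      using power_mono[OF w[OF j], of 2] power_le_one[OF b0 b, of 2] by simp
    have ew: "0 \<le> ?e * (w j)\<^sup>2" "?e * (w j)\<^sup>2 \<le> 1 / 2"
      using e0 err wj mult_mono[OF err wj] by auto
    let ?x = "l\<^sup>2 * (w j)\<^sup>2 / 2"
    \<comment> \<open>The error is split off as a separate factor, using
      \<open>(1 + x) * (1 - y) \<le> 1 + x - y\<close> for nonnegative \<open>x\<close> and
      \<open>y\<close>.\<close>
    have "exp (?x - ?x\<^sup>2 / 2) * exp (- (2 * (?e * (w j)\<^sup>2))) \<le> (1 + ?x) * (1 - ?e * (w j)\<^sup>2)"
      using exp_le_one_plus[of ?x] exp_le_one_minus[OF ew] by (intro mult_mono) auto
    also have "\<dots> \<le> 1 + ?x - ?e * (w j)\<^sup>2"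
      using e0 by (simp add: algebra_simps)
    also have "\<dots> \<le> expectation (?E j)" using ex[OF j] by linarith
    finally show "exp (?x - ?x\<^sup>2 / 2) * exp (- (2 * (?e * (w j)\<^sup>2))) \<le> expectation (?E j)" .
  qed auto
  finally show "exp (l\<^sup>2 / 2 - (2 * ?e + L ^ 4 * b\<^sup>2 / 8)) \<le> expectation (\<lambda>\<omega>. exp (l * T \<omega>))"
    unfolding EP .
qed

end

section \<open>Tails of variables with nearly Gaussian moment generating function\<close>

context prob_space
begin

text \<open>Common form of the Markov, Chebyshev and Chernoff bounds and of the union bound with
  moments: it suffices to dominate an indicator pointwise.\<close>

lemma expectation_indicator_le:
  fixes f :: "'a \<Rightarrow> real"
  assumes A: "A \<in> events" and f: "integrable M f"
    and le: "\<And>\<omega>. \<omega> \<in> space M \<Longrightarrow> indicator A \<omega> \<le> f \<omega>"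
  shows "prob A \<le> expectation f"
proof -
  have "prob A = expectation (indicator A)" using A by simp
  also have "\<dots> \<le> expectation f" by (intro integral_mono) (use A f le in \<open>auto simp: emeasure_eq_measure\<close>)
  finally show ?thesis .
qed

text \<open>The tilt sits at the end \<open>L\<close> of the range where the moment generating
  function is controlled, because the optimal tilt \<open>a\<close> will lie just outside. At
  \<open>a = (1 + \<delta>) * L\<close> the exponent is
  \<open>d - (1 / 2 + \<delta>) * L\<^sup>2\<close>, which still beats a union bound over about
  \<open>exp (L\<^sup>2 / 2)\<close> rows.\<close>

lemma two_sided_chernoff:
  fixes T :: "'a \<Rightarrow> real"
  assumes [measurable]: "T \<in> borel_measurable M" and L: "0 \<le> L"
    and int: "\<And>l. \<bar>l\<bar> \<le> L \<Longrightarrow> integrable M (\<lambda>\<omega>. exp (l * T \<omega>))"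
    and ub: "\<And>l. \<bar>l\<bar> \<le> L \<Longrightarrow> expectation (\<lambda>\<omega>. exp (l * T \<omega>)) \<le> exp (l\<^sup>2 / 2 + d)"
  shows "prob {\<omega> \<in> space M. a \<le> \<bar>T \<omega>\<bar>} \<le> 2 * exp (d + L\<^sup>2 / 2 - L * a)"
proof -
  have i: "integrable M (\<lambda>\<omega>. exp (L * T \<omega>))" "integrable M (\<lambda>\<omega>. exp ((- L) * T \<omega>))"
    by (rule int, use L in simp)+
  have u: "expectation (\<lambda>\<omega>. exp (L * T \<omega>)) \<le> exp (L\<^sup>2 / 2 + d)"
    "expectation (\<lambda>\<omega>. exp ((- L) * T \<omega>)) \<le> exp (L\<^sup>2 / 2 + d)"
    using ub[of L] ub[of "- L"] L by auto
  have "prob {\<omega> \<in> space M. a \<le> \<bar>T \<omega>\<bar>}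
    \<le> expectation (\<lambda>\<omega>. exp (- (L * a)) * (exp (L * T \<omega>) + exp ((- L) * T \<omega>)))"
  proof (rule expectation_indicator_le)
    fix \<omega> assume "\<omega> \<in> space M"
    show "indicator {\<omega> \<in> space M. a \<le> \<bar>T \<omega>\<bar>} \<omega> \<le> exp (- (L * a)) * (exp (L * T \<omega>) + exp ((- L) * T \<omega>))"
    proof (cases "a \<le> \<bar>T \<omega>\<bar>")
      case True
      have "L * a \<le> L * \<bar>T \<omega>\<bar>" using True L by (intro mult_left_mono) auto
      then have "1 \<le> exp (- (L * a) + L * \<bar>T \<omega>\<bar>)" by simp
      also have "\<dots> \<le> exp (- (L * a) + L * T \<omega>) + exp (- (L * a) + (- L) * T \<omega>)"
        by (cases "T \<omega> \<ge> 0") auto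
      finally show ?thesis by (simp only: exp_add distrib_left) (auto simp: indicator_def)
    qed (auto simp: indicator_def)
  qed (use i in auto)
  also have "\<dots> = exp (- (L * a)) * (expectation (\<lambda>\<omega>. exp (L * T \<omega>)) + expectation (\<lambda>\<omega>. exp ((- L) * T \<omega>)))"
    using i by simp
  also have "\<dots> \<le> exp (- (L * a)) * (exp (L\<^sup>2 / 2 + d) + exp (L\<^sup>2 / 2 + d))"
    using u by (intro mult_left_mono add_mono) auto
  also have "\<dots> = 2 * exp (- (L * a) + (L\<^sup>2 / 2 + d))" by (simp only: exp_add) simp
  also have "\<dots> = 2 * exp (d + L\<^sup>2 / 2 - L * a)" by (simp add: algebra_simps)
  finally show ?thesis .
qed

text \<open>
  Under the measure tilted by \<open>exp (\<theta> T)\<close> the mass of \<open>T\<close> sits near \<open>\<theta>\<close>; the two tails outside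
  \<open>[\<theta> - h, \<theta> + h]\<close> are removed by comparing with the tilts at \<open>\<theta> - h\<close> and \<open>\<theta> + h\<close>.
\<close>
lemma tilted_lower_tail:
  fixes T :: "'a \<Rightarrow> real"
  assumes [measurable]: "T \<in> borel_measurable M"
    and h: "0 \<le> h" and lam: "0 \<le> \<theta>" and L: "\<theta> + h \<le> L"
    and int: "\<And>l. \<bar>l\<bar> \<le> L \<Longrightarrow> integrable M (\<lambda>\<omega>. exp (l * T \<omega>))"
    and ub: "\<And>l. \<bar>l\<bar> \<le> L \<Longrightarrow> expectation (\<lambda>\<omega>. exp (l * T \<omega>)) \<le> exp (l\<^sup>2 / 2 + d)"
    and lb: "\<And>l. \<bar>l\<bar> \<le> L \<Longrightarrow> exp (l\<^sup>2 / 2 - d) \<le> expectation (\<lambda>\<omega>. exp (l * T \<omega>))"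
  shows "exp (- (\<theta>\<^sup>2 / 2 + \<theta> * h)) * (exp (- d) - 2 * exp (d - h\<^sup>2 / 2)) \<le> prob {\<omega> \<in> space M. \<theta> - h \<le> T \<omega>}"
proof -
  let ?S = "{\<omega> \<in> space M. \<theta> - h \<le> T \<omega>}"
  have r: "\<bar>\<theta>\<bar> \<le> L" "\<bar>\<theta> - h\<bar> \<le> L" "\<bar>\<theta> + h\<bar> \<le> L" using h lam L by auto
  let ?e = "\<lambda>l \<omega>. exp (l * T \<omega>)"
  let ?f = "\<lambda>\<omega>. exp (\<theta> * (\<theta> + h)) * indicator ?S \<omega> + exp (h * (\<theta> - h)) * ?e (\<theta> - h) \<omega>
      + exp (- (h * (\<theta> + h))) * ?e (\<theta> + h) \<omega>"
  have iS: "integrable M (indicator ?S :: 'a \<Rightarrow> real)"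
    by (intro integrable_real_indicator) (auto simp: emeasure_eq_measure)
  have iI: "integrable M (?e \<theta>)" "integrable M (?e (\<theta> - h))" "integrable M (?e (\<theta> + h))"
    using int r by auto
  have "exp (\<theta>\<^sup>2 / 2 - d) \<le> expectation (?e \<theta>)" by (rule lb) fact
  also have "\<dots> \<le> expectation ?f"
  proof (rule integral_mono)
    fix \<omega> assume sp: "\<omega> \<in> space M"
    consider "T \<omega> < \<theta> - h" | "\<theta> - h \<le> T \<omega>" "T \<omega> \<le> \<theta> + h" | "\<theta> + h < T \<omega>" by linarith
    then show "?e \<theta> \<omega> \<le> ?f \<omega>"
    proof cases
      case 1
      have "h * T \<omega> \<le> h * (\<theta> - h)" using 1 h by (intro mult_left_mono) auto
      then have "?e \<theta> \<omega> \<le> exp (h * (\<theta> - h) + (\<theta> - h) * T \<omega>)" by (simp add: algebra_simps)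
      then show ?thesis using 1 by (simp add: exp_add) (simp add: add_increasing2)
    next
      case 2
      have "\<theta> * T \<omega> \<le> \<theta> * (\<theta> + h)" using 2 lam by (intro mult_left_mono) auto
      then have "?e \<theta> \<omega> \<le> exp (\<theta> * (\<theta> + h)) * indicator ?S \<omega>" using 2 sp by simp
      then show ?thesis by (simp add: add_increasing2)
    next
      case 3
      have "h * (\<theta> + h) \<le> h * T \<omega>" using 3 h by (intro mult_left_mono) auto
      then have "?e \<theta> \<omega> \<le> exp (- (h * (\<theta> + h)) + (\<theta> + h) * T \<omega>)" by (simp add: algebra_simps)
      then have "?e \<theta> \<omega> \<le> exp (- (h * (\<theta> + h))) * ?e (\<theta> + h) \<omega>" by (simp only: exp_add)
      then show ?thesis by (simp add: add_increasing)
    qed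
  qed (use iS iI in \<open>auto intro!: Bochner_Integration.integrable_add integrable_mult_right\<close>)
  also have "expectation ?f = exp (\<theta> * (\<theta> + h)) * prob ?S + exp (h * (\<theta> - h)) * expectation (?e (\<theta> - h))
      + exp (- (h * (\<theta> + h))) * expectation (?e (\<theta> + h))"
    using iS iI by simp
  also have "\<dots> \<le> exp (\<theta> * (\<theta> + h)) * prob ?S + exp (h * (\<theta> - h)) * exp ((\<theta> - h)\<^sup>2 / 2 + d)
      + exp (- (h * (\<theta> + h))) * exp ((\<theta> + h)\<^sup>2 / 2 + d)"
    using ub r by (intro add_mono mult_left_mono) auto
  also have "\<dots> = exp (\<theta> * (\<theta> + h)) * prob ?S + 2 * exp (\<theta>\<^sup>2 / 2 - h\<^sup>2 / 2 + d)"
  proof -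
    \<comment> \<open>Completing the square gives both tilts the same exponent: each tail is smaller
      than the main mass \<open>exp (\<theta>\<^sup>2 / 2)\<close> by the factor
      \<open>exp (- h\<^sup>2 / 2)\<close>, up to \<open>d\<close>.\<close>
    have e: "h * (\<theta> - h) + ((\<theta> - h)\<^sup>2 / 2 + d) = \<theta>\<^sup>2 / 2 - h\<^sup>2 / 2 + d"
      "- (h * (\<theta> + h)) + ((\<theta> + h)\<^sup>2 / 2 + d) = \<theta>\<^sup>2 / 2 - h\<^sup>2 / 2 + d"
      by (simp_all add: power2_eq_square field_simps)
    show ?thesis unfolding exp_add[symmetric] e by simp
  qed
  finally have "exp (- (\<theta> * (\<theta> + h))) * exp (\<theta>\<^sup>2 / 2 - d) \<le>
     exp (- (\<theta> * (\<theta> + h))) * (exp (\<theta> * (\<theta> + h)) * prob ?S + 2 * exp (\<theta>\<^sup>2 / 2 - h\<^sup>2 / 2 + d))"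
    by (intro mult_left_mono) auto
  also have "\<dots> = prob ?S + 2 * (exp (- (\<theta> * (\<theta> + h))) * exp (\<theta>\<^sup>2 / 2 - h\<^sup>2 / 2 + d))"
    by (simp add: algebra_simps flip: exp_add mult.assoc)
  finally have "exp (- (\<theta> * (\<theta> + h))) * exp (\<theta>\<^sup>2 / 2 - d)
     - 2 * (exp (- (\<theta> * (\<theta> + h))) * exp (\<theta>\<^sup>2 / 2 - h\<^sup>2 / 2 + d)) \<le> prob ?S" by simp
  moreover have "exp (- (\<theta> * (\<theta> + h))) * exp (\<theta>\<^sup>2 / 2 - d) = exp (- (\<theta>\<^sup>2 / 2 + \<theta> * h)) * exp (- d)"
    unfolding exp_add[symmetric] by (simp add: power2_eq_square field_simps)
  moreover have "exp (- (\<theta> * (\<theta> + h))) * exp (\<theta>\<^sup>2 / 2 - h\<^sup>2 / 2 + d)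
      = exp (- (\<theta>\<^sup>2 / 2 + \<theta> * h)) * exp (d - h\<^sup>2 / 2)"
    unfolding exp_add[symmetric] by (simp add: power2_eq_square field_simps)
  ultimately show ?thesis by (simp add: algebra_simps)
qed

text \<open>Here 3 is the Gaussian fourth moment, and the added \<open>\<kappa>\<close> closes the
  induction: adding a coefficient \<open>u\<close> to a sum \<open>s\<close> of squares leaves the
  slack \<open>3 * u ^ 4 + 2 * \<kappa> * u\<^sup>2 * s\<close>, which is nonnegative.\<close>

lemma linear_form_moments:
  fixes X :: "'i \<Rightarrow> 'a \<Rightarrow> real" and u :: "'i \<Rightarrow> real"
  assumes "finite J" "indep_vars (\<lambda>_. borel) X J"
    and "\<And>j. j \<in> J \<Longrightarrow> integrable M (\<lambda>\<omega>. X j \<omega> ^ 4)"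
    and "\<And>j. j \<in> J \<Longrightarrow> expectation (X j) = 0"
    and "\<And>j. j \<in> J \<Longrightarrow> expectation (\<lambda>\<omega>. (X j \<omega>)\<^sup>2) = 1"
    and "\<And>j. j \<in> J \<Longrightarrow> expectation (\<lambda>\<omega>. X j \<omega> ^ 4) \<le> \<kappa>"
    and \<kappa>: "0 \<le> \<kappa>"
  shows "integrable M (\<lambda>\<omega>. (\<Sum>j\<in>J. X j \<omega> * u j) ^ 4)
    \<and> expectation (\<lambda>\<omega>. \<Sum>j\<in>J. X j \<omega> * u j) = 0
    \<and> expectation (\<lambda>\<omega>. (\<Sum>j\<in>J. X j \<omega> * u j)\<^sup>2) = (\<Sum>j\<in>J. (u j)\<^sup>2)
    \<and> expectation (\<lambda>\<omega>. (\<Sum>j\<in>J. X j \<omega> * u j) ^ 4) \<le> (3 + \<kappa>) * (\<Sum>j\<in>J. (u j)\<^sup>2)\<^sup>2"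
  using assms(1-6)
proof (induction J rule: finite_induct)
  case (insert i I)
  let ?Y = "\<lambda>\<omega>. X i \<omega> * u i"
  let ?S = "\<lambda>\<omega>. \<Sum>j\<in>I. X j \<omega> * u j"
  let ?s = "\<Sum>j\<in>I. (u j)\<^sup>2"
  have IH: "integrable M (\<lambda>\<omega>. ?S \<omega> ^ 4)" "expectation ?S = 0" "expectation (\<lambda>\<omega>. (?S \<omega>)\<^sup>2) = ?s"
    "expectation (\<lambda>\<omega>. ?S \<omega> ^ 4) \<le> (3 + \<kappa>) * ?s\<^sup>2"
    using insert.IH[OF indep_vars_subset[OF insert.prems(1)]] insert.prems by auto
  have indY: "indep_vars (\<lambda>_. borel) (\<lambda>j \<omega>. X j \<omega> * u j) (insert i I)"
    by (rule indep_vars_compose2[OF insert.prems(1)]) measurable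
  have ind: "indep_var borel ?Y borel ?S"
    using indep_vars_sum[OF insert.hyps indY] .
  have Y: "integrable M (\<lambda>\<omega>. ?Y \<omega> ^ 4)" "expectation ?Y = 0" "expectation (\<lambda>\<omega>. (?Y \<omega>)\<^sup>2) = (u i)\<^sup>2"
    "expectation (\<lambda>\<omega>. ?Y \<omega> ^ 4) \<le> \<kappa> * u i ^ 4"
    using insert.prems by (auto simp: power_mult_distrib intro!: mult_right_mono)
  note m = fourth_moment_indep_add[OF ind Y(1) IH(1) Y(2) IH(2)]
  have s: "0 \<le> ?s" by (intro sum_nonneg) auto
  have "expectation (\<lambda>\<omega>. (?Y \<omega> + ?S \<omega>) ^ 4) \<le> \<kappa> * u i ^ 4 + 6 * ((u i)\<^sup>2 * ?s) + (3 + \<kappa>) * ?s\<^sup>2"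
    using m(4) Y(3,4) IH(3,4) by simp
  also have "\<dots> \<le> (3 + \<kappa>) * ((u i)\<^sup>2 + ?s)\<^sup>2"
  proof -
    have "0 \<le> 3 * u i ^ 4 + 2 * \<kappa> * ((u i)\<^sup>2 * ?s)" using \<kappa> s by auto
    also have "\<dots> = (3 + \<kappa>) * ((u i)\<^sup>2 + ?s)\<^sup>2 - (\<kappa> * u i ^ 4 + 6 * ((u i)\<^sup>2 * ?s) + (3 + \<kappa>) * ?s\<^sup>2)"
      by (simp add: numeral_eq_Suc algebra_simps)
    finally show ?thesis by simp
  qed
  finally show ?case
    using insert.hyps m(1-3) Y(3) IH(3) by simp
qed (use \<kappa> in \<open>simp add: prob_space\<close>)

end

section \<open>Matrices with independent standardized entries\<close>

text \<open>A factor is described by moments and one common bound \<open>\<kappa>\<close> instead of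
  by a law, so that all estimates depend on \<open>\<kappa>\<close> alone and one threshold serves
  all factors. The sign of \<open>\<kappa>\<close> is stated separately because the matrix may be
  empty.\<close>

locale standard_matrix = prob_space M for M :: "'a measure" +
  fixes X :: "nat \<times> nat \<Rightarrow> 'a \<Rightarrow> real" and r c :: nat and \<kappa> :: real
  assumes indep: "indep_vars (\<lambda>_. borel) X ({..<r} \<times> {..<c})"
    and int4: "\<And>i j. i < r \<Longrightarrow> j < c \<Longrightarrow> integrable M (\<lambda>\<omega>. X (i, j) \<omega> ^ 4)"
    and mean: "\<And>i j. i < r \<Longrightarrow> j < c \<Longrightarrow> expectation (X (i, j)) = 0"
    and second: "\<And>i j. i < r \<Longrightarrow> j < c \<Longrightarrow> expectation (\<lambda>\<omega>. (X (i, j) \<omega>)\<^sup>2) = 1"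
    and fourth: "\<And>i j. i < r \<Longrightarrow> j < c \<Longrightarrow> expectation (\<lambda>\<omega>. X (i, j) \<omega> ^ 4) \<le> \<kappa>"
    and \<kappa>_nonneg: "0 \<le> \<kappa>"
begin

lemma entry_measurable: "i < r \<Longrightarrow> j < c \<Longrightarrow> X (i, j) \<in> borel_measurable M"
  using indep by (auto simp: indep_vars_def)

text \<open>The independent entries are grouped by row. The functions \<open>f j\<close> are
  arbitrary so that the lemma covers plain and truncated sums alike.\<close>

lemma indep_row_sums:
  assumes f: "\<And>j. f j \<in> borel_measurable borel"
  shows "indep_vars (\<lambda>_. borel) (\<lambda>i \<omega>. \<Sum>j<c. f j (X (i, j) \<omega>) :: real) {..<r}"
proof -
  have "indep_vars (\<lambda>i. PiM ({i} \<times> {..<c}) (\<lambda>_. borel)) (\<lambda>i \<omega>. restrict (\<lambda>ij. X ij \<omega>) ({i} \<times> {..<c})) {..<r}"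
    by (rule indep_vars_restrict[OF indep]) (auto simp: disjoint_family_on_def)
  then have "indep_vars (\<lambda>_. borel) (\<lambda>i \<omega>. \<Sum>j<c. f j (restrict (\<lambda>ij. X ij \<omega>) ({i} \<times> {..<c}) (i, j))) {..<r}"
    by (rule indep_vars_compose2[where Y = "\<lambda>i g. \<Sum>j<c. f j (g (i, j))"])
       (intro borel_measurable_sum measurable_compose[OF _ f] measurable_component_singleton; simp)
  then show ?thesis by simp
qed

lemma indep_row:
  assumes i: "i < r"
  shows "indep_vars (\<lambda>_. borel) (\<lambda>j. X (i, j)) {..<c}"
proof -
  have "indep_vars (\<lambda>j. PiM {(i, j)} (\<lambda>_. borel)) (\<lambda>j \<omega>. restrict (\<lambda>ij. X ij \<omega>) {(i, j)}) {..<c}"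
    by (rule indep_vars_restrict[OF indep]) (use i in \<open>auto simp: disjoint_family_on_def\<close>)
  then have "indep_vars (\<lambda>_. borel) (\<lambda>j \<omega>. restrict (\<lambda>ij. X ij \<omega>) {(i, j)} (i, j)) {..<c}"
    by (rule indep_vars_compose2[where Y = "\<lambda>j g. g (i, j)"]) (intro measurable_component_singleton; simp)
  then show ?thesis by simp
qed

definition row_form :: "(nat \<Rightarrow> real) \<Rightarrow> nat \<Rightarrow> 'a \<Rightarrow> real" where
  "row_form u i \<omega> = (\<Sum>j<c. X (i, j) \<omega> * u j)"

lemma row_form_measurable [measurable]: "i < r \<Longrightarrow> row_form u i \<in> borel_measurable M"
  unfolding row_form_def by (intro borel_measurable_sum borel_measurable_times) (auto simp: entry_measurable)

lemma row_form_moments: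
  fixes u :: "nat \<Rightarrow> real"
  assumes i: "i < r"
  defines "s \<equiv> (\<Sum>j<c. (u j)\<^sup>2)"
  shows "integrable M (\<lambda>\<omega>. row_form u i \<omega> ^ 4)"
    and "expectation (row_form u i) = 0"
    and "expectation (\<lambda>\<omega>. (row_form u i \<omega>)\<^sup>2) = s"
    and "expectation (\<lambda>\<omega>. row_form u i \<omega> ^ 4) \<le> (3 + \<kappa>) * s\<^sup>2"
  using linear_form_moments[OF _ indep_row[OF i] int4[OF i] mean[OF i] second[OF i] fourth[OF i] \<kappa>_nonneg, of u]
  unfolding row_form_def s_def by (auto simp: row_form_def[abs_def])

lemma indep_row_forms: "indep_vars (\<lambda>_. borel) (row_form u) {..<r}"
  using indep_row_sums[of "\<lambda>j x. x * u j"] by (simp add: row_form_def[abs_def])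

text \<open>Chebyshev's inequality: the squares minus \<open>s\<close> are centered and independent
  over the rows, and the fourth moment of a row form bounds their variance.\<close>

lemma row_form_norm_concentration:
  assumes s: "s = (\<Sum>j<c. (u j)\<^sup>2)" "0 < s" and e: "0 < e" and r: "0 < r"
  shows "prob {\<omega> \<in> space M. e \<le> \<bar>(\<Sum>i<r. (row_form u i \<omega>)\<^sup>2) / (real r * s) - 1\<bar>} \<le> (3 + \<kappa>) / (real r * e\<^sup>2)"
proof -
  let ?Z = "\<lambda>i \<omega>. (row_form u i \<omega>)\<^sup>2 - s"
  have indZ: "indep_vars (\<lambda>_. borel) ?Z {..<r}"
    by (rule indep_vars_compose2[OF indep_row_forms]) measurable
  have mom: "integrable M (\<lambda>\<omega>. (?Z i \<omega>)\<^sup>2)" "expectation (?Z i) = 0"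
    "expectation (\<lambda>\<omega>. (?Z i \<omega>)\<^sup>2) \<le> (3 + \<kappa>) * s\<^sup>2" if i: "i < r" for i
  proof -
    note m = row_form_moments[OF i, of u, folded s(1)]
    have i2: "integrable M (\<lambda>\<omega>. (row_form u i \<omega>)\<^sup>2)"
      using integrable_power_of_power4[OF _ m(1), of 2] i by simp
    have eq: "(?Z i \<omega>)\<^sup>2 = row_form u i \<omega> ^ 4 - 2 * s * (row_form u i \<omega>)\<^sup>2 + s\<^sup>2" for \<omega>
      by (simp add: numeral_eq_Suc algebra_simps)
    show "integrable M (\<lambda>\<omega>. (?Z i \<omega>)\<^sup>2)" unfolding eq using m i2 by auto
    show "expectation (?Z i) = 0" using m i2 by (simp add: prob_space)
    have "expectation (\<lambda>\<omega>. (?Z i \<omega>)\<^sup>2) = expectation (\<lambda>\<omega>. row_form u i \<omega> ^ 4) - s\<^sup>2"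
      unfolding eq using m i2 by (simp add: prob_space power2_eq_square)
    then show "expectation (\<lambda>\<omega>. (?Z i \<omega>)\<^sup>2) \<le> (3 + \<kappa>) * s\<^sup>2"
      using m(4) zero_le_power2[of s] by linarith
  qed
  let ?V = "\<lambda>\<omega>. \<Sum>i<r. ?Z i \<omega>"
  have V: "integrable M (\<lambda>\<omega>. (?V \<omega>)\<^sup>2)" "expectation (\<lambda>\<omega>. (?V \<omega>)\<^sup>2) = (\<Sum>i<r. expectation (\<lambda>\<omega>. (?Z i \<omega>)\<^sup>2))"
    using sum_second_moment_indep[OF _ indZ] mom by auto
  have V2: "expectation (\<lambda>\<omega>. (?V \<omega>)\<^sup>2) \<le> real r * ((3 + \<kappa>) * s\<^sup>2)"
    unfolding V using sum_bounded_above[of "{..<r}" "\<lambda>i. expectation (\<lambda>\<omega>. (?Z i \<omega>)\<^sup>2)" "(3 + \<kappa>) * s\<^sup>2"] mom by simp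
  have Vm: "?V \<in> borel_measurable M" by measurable
  have eq: "(\<Sum>i<r. (row_form u i \<omega>)\<^sup>2) / (real r * s) - 1 = ?V \<omega> / (real r * s)" for \<omega>
    using r s by (simp add: sum_subtractf field_simps)
  have rse: "0 < (real r * s * e)\<^sup>2" using r s e by simp
  have "prob {\<omega> \<in> space M. e \<le> \<bar>(\<Sum>i<r. (row_form u i \<omega>)\<^sup>2) / (real r * s) - 1\<bar>}
    \<le> expectation (\<lambda>\<omega>. (?V \<omega>)\<^sup>2 / (real r * s * e)\<^sup>2)"
    unfolding eq
  proof (rule expectation_indicator_le)
    fix \<omega> assume "\<omega> \<in> space M"
    show "indicator {\<omega> \<in> space M. e \<le> \<bar>?V \<omega> / (real r * s)\<bar>} \<omega> \<le> (?V \<omega>)\<^sup>2 / (real r * s * e)\<^sup>2"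
    proof (cases "e \<le> \<bar>?V \<omega> / (real r * s)\<bar>")
      case True
      then have "real r * s * e \<le> \<bar>?V \<omega>\<bar>"
        using r s by (simp add: abs_mult pos_le_divide_eq mult.commute)
      then have "(real r * s * e)\<^sup>2 \<le> (?V \<omega>)\<^sup>2"
        using power_mono[of "real r * s * e" "\<bar>?V \<omega>\<bar>" 2] r s e by simp
      then show ?thesis using rse by (auto simp: indicator_def field_simps)
    qed (auto simp: indicator_def)
  qed (use V Vm in auto)
  also have "\<dots> = expectation (\<lambda>\<omega>. (?V \<omega>)\<^sup>2) / (real r * s * e)\<^sup>2"
    using V by simp
  also have "\<dots> \<le> real r * ((3 + \<kappa>) * s\<^sup>2) / (real r * s * e)\<^sup>2"
    using V2 rse by (intro divide_right_mono) auto
  also have "\<dots> = (3 + \<kappa>) / (real r * e\<^sup>2)"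
    using r s e by (simp add: power2_eq_square field_simps)
  finally show ?thesis .
qed

text \<open>Markov instead of Chebyshev, since the variance of fourth powers would involve eighth
  moments of the entries. The price is that a small failure probability needs a large
  \<open>K\<close>.\<close>

lemma row_form_fourth_power_bound:
  assumes s: "s = (\<Sum>j<c. (u j)\<^sup>2)" "0 < s" and K: "0 < K" and r: "0 < r"
  shows "prob {\<omega> \<in> space M. K * real r * s\<^sup>2 \<le> (\<Sum>i<r. row_form u i \<omega> ^ 4)} \<le> (3 + \<kappa>) / K"
proof -
  have int: "integrable M (\<lambda>\<omega>. row_form u i \<omega> ^ 4)" if "i < r" for i using row_form_moments[OF that] by simp
  have pos: "0 < K * real r * s\<^sup>2" using K r s by simp
  have "prob {\<omega> \<in> space M. K * real r * s\<^sup>2 \<le> (\<Sum>i<r. row_form u i \<omega> ^ 4)}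
    \<le> expectation (\<lambda>\<omega>. (\<Sum>i<r. row_form u i \<omega> ^ 4) / (K * real r * s\<^sup>2))"
  proof (rule expectation_indicator_le)
    fix \<omega> assume "\<omega> \<in> space M"
    have "0 \<le> (\<Sum>i<r. row_form u i \<omega> ^ 4)" by (intro sum_nonneg) auto
    then show "indicator {\<omega> \<in> space M. K * real r * s\<^sup>2 \<le> (\<Sum>i<r. row_form u i \<omega> ^ 4)} \<omega>
       \<le> (\<Sum>i<r. row_form u i \<omega> ^ 4) / (K * real r * s\<^sup>2)"
      using pos by (auto simp: indicator_def pos_le_divide_eq intro!: divide_nonneg_pos)
  qed (use int in \<open>auto intro!: integrable_divide_zero Bochner_Integration.integrable_sum\<close>)
  also have "\<dots> = (\<Sum>i<r. expectation (\<lambda>\<omega>. row_form u i \<omega> ^ 4)) / (K * real r * s\<^sup>2)"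
    using int by simp
  also have "\<dots> \<le> real r * ((3 + \<kappa>) * s\<^sup>2) / (K * real r * s\<^sup>2)"
    using sum_bounded_above[of "{..<r}" "\<lambda>i. expectation (\<lambda>\<omega>. row_form u i \<omega> ^ 4)" "(3 + \<kappa>) * s\<^sup>2"]
      row_form_moments(4)[of _ u, folded s(1)] pos by (intro divide_right_mono) auto
  also have "\<dots> = (3 + \<kappa>) / K" using r s(2) by simp
  finally show ?thesis .
qed

text \<open>Union bound and Markov's inequality of order four at once: the sum of all normalized
  fourth powers dominates the indicator.\<close>

lemma large_entry_bound:
  assumes t: "0 < t"
  shows "prob {\<omega> \<in> space M. \<exists>i<r. \<exists>j<c. t < \<bar>X (i, j) \<omega> * w j\<bar>} \<le> real r * \<kappa> * (\<Sum>j<c. w j ^ 4) / t ^ 4"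
proof -
  have i: "integrable M (\<lambda>\<omega>. \<Sum>j<c. (X (i, j) \<omega> * w j) ^ 4 / t ^ 4)" if "i < r" for i
    using int4 that by (auto simp: power_mult_distrib)
  have "prob {\<omega> \<in> space M. \<exists>i<r. \<exists>j<c. t < \<bar>X (i, j) \<omega> * w j\<bar>}
     \<le> expectation (\<lambda>\<omega>. \<Sum>i<r. \<Sum>j<c. (X (i, j) \<omega> * w j) ^ 4 / t ^ 4)"
  proof (rule expectation_indicator_le)
    have m: "{\<omega> \<in> space M. t < \<bar>X (i, j) \<omega> * w j\<bar>} \<in> events" if "i < r" "j < c" for i j
      using entry_measurable[OF that] by measurable
    have "{\<omega> \<in> space M. \<exists>i<r. \<exists>j<c. t < \<bar>X (i, j) \<omega> * w j\<bar>}
      = (\<Union>i<r. \<Union>j<c. {\<omega> \<in> space M. t < \<bar>X (i, j) \<omega> * w j\<bar>})" by auto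
    also have "\<dots> \<in> events" using m by (intro sets.finite_UN) auto
    finally show "{\<omega> \<in> space M. \<exists>i<r. \<exists>j<c. t < \<bar>X (i, j) \<omega> * w j\<bar>} \<in> events" .
    fix \<omega> assume "\<omega> \<in> space M"
    have nn: "0 \<le> (\<Sum>i<r. \<Sum>j<c. (X (i, j) \<omega> * w j) ^ 4 / t ^ 4)" by (intro sum_nonneg) auto
    have "1 \<le> (\<Sum>i<r. \<Sum>j<c. (X (i, j) \<omega> * w j) ^ 4 / t ^ 4)" if ij: "i < r" "j < c" "t < \<bar>X (i, j) \<omega> * w j\<bar>" for i j
    proof -
      have "t ^ 4 \<le> (X (i, j) \<omega> * w j) ^ 4"
        using power_mono[of t "\<bar>X (i, j) \<omega> * w j\<bar>" 4] ij t by (simp add: power_even_abs)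
      then have "1 \<le> (X (i, j) \<omega> * w j) ^ 4 / t ^ 4" using t by simp
      also have "\<dots> \<le> (\<Sum>j<c. (X (i, j) \<omega> * w j) ^ 4 / t ^ 4)"
        by (rule member_le_sum[of j "{..<c}" "\<lambda>j. (X (i, j) \<omega> * w j) ^ 4 / t ^ 4"]) (use ij in auto)
      also have "\<dots> \<le> (\<Sum>i<r. \<Sum>j<c. (X (i, j) \<omega> * w j) ^ 4 / t ^ 4)"
        by (rule member_le_sum[of i "{..<r}" "\<lambda>i. \<Sum>j<c. (X (i, j) \<omega> * w j) ^ 4 / t ^ 4"])
           (use ij in \<open>auto intro!: sum_nonneg\<close>)
      finally show ?thesis .
    qed
    then show "indicator {\<omega> \<in> space M. \<exists>i<r. \<exists>j<c. t < \<bar>X (i, j) \<omega> * w j\<bar>} \<omega>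
        \<le> (\<Sum>i<r. \<Sum>j<c. (X (i, j) \<omega> * w j) ^ 4 / t ^ 4)"
      using nn by (auto simp: indicator_def)
  qed (use i in auto)
  also have "\<dots> = (\<Sum>i<r. \<Sum>j<c. expectation (\<lambda>\<omega>. X (i, j) \<omega> ^ 4) * w j ^ 4 / t ^ 4)"
    using i int4 by (simp add: power_mult_distrib)
  also have "\<dots> \<le> (\<Sum>i<r. \<Sum>j<c. \<kappa> * w j ^ 4 / t ^ 4)"
    using fourth t by (intro sum_mono divide_right_mono mult_right_mono) auto
  also have "\<dots> = real r * \<kappa> * (\<Sum>j<c. w j ^ 4) / t ^ 4"
    by (simp add: sum_distrib_left sum_divide_distrib mult.assoc)
  finally show ?thesis .
qed

end

section \<open>Largest row sum for a fixed unit vector\<close>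

context standard_matrix
begin

text \<open>
  The three summands bound the probabilities that some entry is truncated, that some truncated row sum
  is too large, and that all truncated row sums are too small.
\<close>
lemma max_row_form_tail:
  assumes w2: "(\<Sum>j<c. (w j)\<^sup>2) = 1" and w: "\<And>j. j < c \<Longrightarrow> \<bar>w j\<bar> \<le> b" and b: "b \<le> 1"
    and t: "0 < t" and L: "0 \<le> L" and \<delta>: "0 < \<delta>" "\<delta> \<le> 1 / 2" and r: "0 < r"
    and err: "trunc_err \<kappa> L t b \<le> 1 / 2"
  defines "d \<equiv> 2 * trunc_err \<kappa> L t b + L ^ 4 * b\<^sup>2 / 8"
  shows "prob {\<omega> \<in> space M. \<not> ((\<exists>i<r. (1 - 3 * \<delta>) * L \<le> \<bar>row_form w i \<omega>\<bar>)
      \<and> (\<forall>i<r. \<bar>row_form w i \<omega>\<bar> < (1 + \<delta>) * L))}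
    \<le> real r * \<kappa> * (\<Sum>j<c. w j ^ 4) / t ^ 4
      + real r * (2 * exp (d + L\<^sup>2 / 2 - L * ((1 + \<delta>) * L)))
      + exp (- (real r * (exp (- ((1 - 2 * \<delta>) * (L\<^sup>2 / 2))) * (exp (- d) - 2 * exp (d - (\<delta> * L)\<^sup>2 / 2)))))"
proof -
  define T where "T i \<omega> = (\<Sum>j<c. trunc t (X (i, j) \<omega> * w j))" for i \<omega>
  have indT: "indep_vars (\<lambda>_. borel) T {..<r}"
    using indep_row_sums[of "\<lambda>j x. trunc t (x * w j)"] by (simp add: T_def[abs_def])
  have Tm: "T i \<in> borel_measurable M" if "i < r" for i
    using indT that by (auto simp: indep_vars_def)
  have mgf: "integrable M (\<lambda>\<omega>. exp (l * T i \<omega>))" "expectation (\<lambda>\<omega>. exp (l * T i \<omega>)) \<le> exp (l\<^sup>2 / 2 + d)"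
    "exp (l\<^sup>2 / 2 - d) \<le> expectation (\<lambda>\<omega>. exp (l * T i \<omega>))" if "i < r" "\<bar>l\<bar> \<le> L" for i l
    using trunc_sum_mgf[OF _ indep_row[OF that(1)] int4[OF that(1)] mean[OF that(1)] second[OF that(1)]
      fourth[OF that(1)] w _ t that(2) b err] w2
    by (auto simp: d_def T_def)
  let ?B1 = "{\<omega> \<in> space M. \<exists>i<r. \<exists>j<c. t < \<bar>X (i, j) \<omega> * w j\<bar>}"
  let ?B2 = "\<lambda>i. {\<omega> \<in> space M. (1 + \<delta>) * L \<le> \<bar>T i \<omega>\<bar>}"
  \<comment> \<open>A one-sided event suffices: if no absolute value reaches the lower threshold,
    then no \<open>T i\<close> does. Written with preimages, it factorizes by independence of the
    rows.\<close>
  let ?B3 = "\<Inter>i\<in>{..<r}. T i -` {..<(1 - 3 * \<delta>) * L} \<inter> space M"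
  let ?q = "exp (- ((1 - 2 * \<delta>) * (L\<^sup>2 / 2))) * (exp (- d) - 2 * exp (d - (\<delta> * L)\<^sup>2 / 2))"
  have Xm: "{\<omega> \<in> space M. t < \<bar>X (i, j) \<omega> * w j\<bar>} \<in> events" if "i < r" "j < c" for i j
    using entry_measurable[OF that] by measurable
  have B1: "?B1 \<in> events"
  proof -
    have "?B1 = (\<Union>i<r. \<Union>j<c. {\<omega> \<in> space M. t < \<bar>X (i, j) \<omega> * w j\<bar>})" by auto
    also have "\<dots> \<in> events" using Xm by (intro sets.finite_UN) auto
    finally show ?thesis .
  qed
  have B2: "?B2 i \<in> events" if "i < r" for i using Tm[OF that] by measurable
  have B2U: "(\<Union>i<r. ?B2 i) \<in> events"
    by (rule sets.finite_UN) (use B2 in blast)+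
  have B3i: "T i -` {..<(1 - 3 * \<delta>) * L} \<inter> space M \<in> events" if "i < r" for i
    using Tm[OF that] by (auto intro: measurable_sets)
  have B3: "?B3 \<in> events" using r B3i by (intro sets.finite_INT) auto
  have sub: "{\<omega> \<in> space M. \<not> ((\<exists>i<r. (1 - 3 * \<delta>) * L \<le> \<bar>row_form w i \<omega>\<bar>)
      \<and> (\<forall>i<r. \<bar>row_form w i \<omega>\<bar> < (1 + \<delta>) * L))} \<subseteq> (?B1 \<union> (\<Union>i<r. ?B2 i)) \<union> ?B3"
  proof
    fix \<omega> assume \<omega>: "\<omega> \<in> {\<omega> \<in> space M. \<not> ((\<exists>i<r. (1 - 3 * \<delta>) * L \<le> \<bar>row_form w i \<omega>\<bar>)
      \<and> (\<forall>i<r. \<bar>row_form w i \<omega>\<bar> < (1 + \<delta>) * L))}"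
    show "\<omega> \<in> (?B1 \<union> (\<Union>i<r. ?B2 i)) \<union> ?B3"
    proof (cases "\<omega> \<in> ?B1")
      case False
      then have "\<not> t < \<bar>X (i, j) \<omega> * w j\<bar>" if "i < r" "j < c" for i j
        using that \<omega> by blast
      then have "trunc t (X (i, j) \<omega> * w j) = X (i, j) \<omega> * w j" if "i < r" "j < c" for i j
        using that by (simp add: trunc_def not_less)
      then have eq: "T i \<omega> = row_form w i \<omega>" if "i < r" for i
        using that by (simp add: T_def row_form_def)
      show ?thesis
      proof (cases "\<exists>i<r. (1 + \<delta>) * L \<le> \<bar>row_form w i \<omega>\<bar>")
        case True
        then show ?thesis using \<omega> eq by auto
      next
        case False
        then have "\<bar>row_form w i \<omega>\<bar> < (1 - 3 * \<delta>) * L" if "i < r" for i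
          using \<omega> that by (auto simp: not_le)
        then have "T i \<omega> < (1 - 3 * \<delta>) * L" if "i < r" for i
          using eq[OF that] that by (metis abs_ge_self le_less_trans)
        then show ?thesis using \<omega> by auto
      qed
    qed simp
  qed
  have "prob (\<Union>i<r. ?B2 i) \<le> (\<Sum>i<r. prob (?B2 i))"
    by (rule finite_measure_subadditive_finite) (use B2 in blast)+
  also have "\<dots> \<le> (\<Sum>i<r. 2 * exp (d + L\<^sup>2 / 2 - L * ((1 + \<delta>) * L)))"
    by (intro sum_mono two_sided_chernoff) (use L mgf Tm in auto)
  finally have p2: "prob (\<Union>i<r. ?B2 i) \<le> real r * (2 * exp (d + L\<^sup>2 / 2 - L * ((1 + \<delta>) * L)))" by simp
  have low: "prob (T i -` {..<(1 - 3 * \<delta>) * L} \<inter> space M) \<le> exp (- ?q)" if i: "i < r" for i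
  proof -
    \<comment> \<open>The tilt \<open>\<theta> = (1 - 2 * \<delta>) * L\<close> with window
      \<open>h = \<delta> * L\<close> stays within the admissible range and starts the window at
      \<open>(1 - 3 * \<delta>) * L\<close>. Its cost
      \<open>\<theta>\<^sup>2 / 2 + \<theta> * h\<close> collapses to
      \<open>(1 - 2 * \<delta>) * L\<^sup>2 / 2\<close>, strictly below
      \<open>L\<^sup>2 / 2\<close>, so among \<open>exp (L\<^sup>2 / 2)\<close> rows many are
      expected to succeed.\<close>
    have "exp (- (((1 - 2 * \<delta>) * L)\<^sup>2 / 2 + ((1 - 2 * \<delta>) * L) * (\<delta> * L))) * (exp (- d) - 2 * exp (d - (\<delta> * L)\<^sup>2 / 2))
      \<le> prob {\<omega> \<in> space M. (1 - 2 * \<delta>) * L - \<delta> * L \<le> T i \<omega>}"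
    proof (rule tilted_lower_tail)
      show "(1 - 2 * \<delta>) * L + \<delta> * L \<le> L" using L \<delta> by (simp add: algebra_simps)
    qed (use L \<delta> mgf[OF i] Tm[OF i] in auto)
    moreover have "((1 - 2 * \<delta>) * L)\<^sup>2 / 2 + ((1 - 2 * \<delta>) * L) * (\<delta> * L) = (1 - 2 * \<delta>) * (L\<^sup>2 / 2)"
      by (simp add: power2_eq_square field_simps)
    moreover have "(1 - 2 * \<delta>) * L - \<delta> * L = (1 - 3 * \<delta>) * L" by (simp add: algebra_simps)
    ultimately have q: "?q \<le> prob {\<omega> \<in> space M. (1 - 3 * \<delta>) * L \<le> T i \<omega>}" by simp
    have "prob (T i -` {..<(1 - 3 * \<delta>) * L} \<inter> space M) = prob (space M - {\<omega> \<in> space M. (1 - 3 * \<delta>) * L \<le> T i \<omega>})"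
      by (rule arg_cong[of _ _ prob]) auto
    also have "\<dots> = 1 - prob {\<omega> \<in> space M. (1 - 3 * \<delta>) * L \<le> T i \<omega>}"
      using Tm[OF i] by (intro prob_compl) measurable
    also have "\<dots> \<le> 1 + - ?q" using q by simp
    also have "\<dots> \<le> exp (- ?q)" by (rule exp_ge_add_one_self)
    finally show ?thesis .
  qed
  have "prob ?B3 = (\<Prod>i<r. prob (T i -` {..<(1 - 3 * \<delta>) * L} \<inter> space M))"
    by (rule indep_varsD_finite[OF indT]) (use r in auto)
  also have "\<dots> \<le> (\<Prod>i<r. exp (- ?q))"
    using low by (intro prod_mono) auto
  also have "\<dots> = exp (- (real r * ?q))" by (simp flip: exp_of_nat_mult)
  finally have p3: "prob ?B3 \<le> exp (- (real r * ?q))" .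
  have "prob {\<omega> \<in> space M. \<not> ((\<exists>i<r. (1 - 3 * \<delta>) * L \<le> \<bar>row_form w i \<omega>\<bar>)
      \<and> (\<forall>i<r. \<bar>row_form w i \<omega>\<bar> < (1 + \<delta>) * L))} \<le> prob ((?B1 \<union> (\<Union>i<r. ?B2 i)) \<union> ?B3)"
    by (rule finite_measure_mono[OF sub]) (intro sets.Un B1 B2U B3)
  also have "\<dots> \<le> prob ?B1 + prob (\<Union>i<r. ?B2 i) + prob ?B3"
    by (rule order_trans[OF measure_Un_le[OF sets.Un[OF B1 B2U] B3] add_right_mono[OF measure_Un_le[OF B1 B2U]]])
  also have "\<dots> \<le> real r * \<kappa> * (\<Sum>j<c. w j ^ 4) / t ^ 4
      + real r * (2 * exp (d + L\<^sup>2 / 2 - L * ((1 + \<delta>) * L))) + exp (- (real r * ?q))"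
    by (intro add_mono large_entry_bound[OF t] p2 p3)
  finally show ?thesis .
qed

end

section \<open>Asymptotics as the number of rows grows\<close>

lemma exp_quarter_bounds: "3 / 4 \<le> exp (- 1 / 4 :: real)" "exp (1 / 4 :: real) \<le> 4 / 3"
proof -
  show 1: "3 / 4 \<le> exp (- 1 / 4 :: real)" using exp_ge_add_one_self[of "- 1 / 4 :: real"] by simp
  have "exp (1 / 4 :: real) = 1 / exp (- 1 / 4)" by (simp add: exp_minus inverse_eq_divide)
  also have "\<dots> \<le> 1 / (3 / 4)" by (rule divide_left_mono[OF 1]) auto
  finally show "exp (1 / 4 :: real) \<le> 4 / 3" by simp
qed

text \<open>To leading order, \<open>max_scale n\<close> is the largest absolute value among
  \<open>n\<close> independent standard Gaussian variables.\<close>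

definition max_scale :: "real \<Rightarrow> real" where
  "max_scale x = sqrt (2 * ln x)"

lemma max_scale_power2: "1 \<le> x \<Longrightarrow> (max_scale x)\<^sup>2 = 2 * ln x"
  by (simp add: max_scale_def)

text \<open>
  Truncation at \<open>max_scale x / 16\<close> keeps the factor \<open>exp (L * c)\<close> of the Taylor remainder at \<open>x powr (1 / 8)\<close>,
  which is beaten by the bound of order \<open>x powr (- 1 / 4)\<close> on the weights.
\<close>
lemma trunc_err_asymp:
  assumes "0 < K"
  shows "((\<lambda>x. trunc_err \<kappa> (max_scale x) (max_scale x / 16) ((K / x) powr (1 / 4))) \<longlongrightarrow> 0) at_top"
proof -
  have "eventually (\<lambda>x. trunc_err \<kappa> (max_scale x) (max_scale x / 16) ((K / x) powr (1 / 4))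
     = sqrt (2 * ln x) * \<kappa> * ((K / x) powr (1 / 4))\<^sup>2 / (sqrt (2 * ln x) / 16) ^ 3
       + (sqrt (2 * ln x))\<^sup>2 * \<kappa> * ((K / x) powr (1 / 4))\<^sup>2 / (2 * (sqrt (2 * ln x) / 16)\<^sup>2)
       + sqrt (2 * ln x) ^ 3 * (K / x) powr (1 / 4) * (1 + \<kappa>) * x powr (1 / 8)) at_top"
    using eventually_gt_at_top[of 1]
  proof eventually_elim
    case (elim x)
    have "exp (max_scale x * (max_scale x / 16)) = x powr (1 / 8)"
      using max_scale_power2[of x] elim by (simp add: powr_def flip: power2_eq_square)
    then show ?case by (simp add: trunc_err_def max_scale_def)
  qed
  moreover have "((\<lambda>x. sqrt (2 * ln x) * \<kappa> * ((K / x) powr (1 / 4))\<^sup>2 / (sqrt (2 * ln x) / 16) ^ 3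
       + (sqrt (2 * ln x))\<^sup>2 * \<kappa> * ((K / x) powr (1 / 4))\<^sup>2 / (2 * (sqrt (2 * ln x) / 16)\<^sup>2)
       + sqrt (2 * ln x) ^ 3 * (K / x) powr (1 / 4) * (1 + \<kappa>) * x powr (1 / 8)) \<longlongrightarrow> 0) at_top"
    using assms by real_asymp
  ultimately show ?thesis using tendsto_cong by fast
qed

lemma max_scale_power4_asymp:
  assumes "0 < K"
  shows "((\<lambda>x. max_scale x ^ 4 * ((K / x) powr (1 / 4))\<^sup>2 / 8) \<longlongrightarrow> 0) at_top"
  unfolding max_scale_def using assms by real_asymp

text \<open>The threshold is chosen before the space, the matrix, the number of columns and the
  weights, so that it can later be applied at every good value of a random vector and for every
  tuple.\<close>

lemma max_row_form_tail_asymp: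
  fixes K \<kappa> \<delta> \<eta> :: real
  assumes K: "0 < K" and \<delta>: "0 < \<delta>" "\<delta> \<le> 1 / 2" and \<eta>: "0 < \<eta>"
  shows "\<exists>N. \<forall>(M :: 'a measure) X r c w. standard_matrix M X r c \<kappa> \<longrightarrow> N \<le> r \<longrightarrow>
     (\<Sum>j<c. (w j)\<^sup>2) = 1 \<longrightarrow> (\<Sum>j<c. w j ^ 4) \<le> K / real r \<longrightarrow>
     measure M {\<omega> \<in> space M. \<not> ((\<exists>i<r. (1 - 3 * \<delta>) * max_scale (real r) \<le> \<bar>standard_matrix.row_form X c w i \<omega>\<bar>)
      \<and> (\<forall>i<r. \<bar>standard_matrix.row_form X c w i \<omega>\<bar> < (1 + \<delta>) * max_scale (real r)))} \<le> \<eta>"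
proof -
  let ?b = "\<lambda>x. (K / x) powr (1 / 4)"
  let ?e = "\<lambda>x. trunc_err \<kappa> (max_scale x) (max_scale x / 16) (?b x)"
  let ?d = "\<lambda>x. 2 * ?e x + max_scale x ^ 4 * (?b x)\<^sup>2 / 8"
  have ed: "(?d \<longlongrightarrow> 0) at_top"
    using tendsto_add[OF tendsto_mult_left[OF trunc_err_asymp[OF K, of \<kappa>], of 2] max_scale_power4_asymp[OF K]]
    by simp
  have "eventually (\<lambda>x. ?e x \<le> 1 / 2) at_top"
    by (rule eventually_mono[OF order_tendstoD(2)[OF trunc_err_asymp[OF K, of \<kappa>], of "1 / 2"]]) simp_all
  moreover have "eventually (\<lambda>x. ?d x \<le> 1 / 4) at_top"
    by (rule eventually_mono[OF order_tendstoD(2)[OF ed, of "1 / 4"]]) simp_all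
  moreover have "eventually (\<lambda>x::real. ?b x \<le> 1) at_top"
    using K by real_asymp
  \<comment> \<open>The constant 3/32 is tuned to \<open>?d \<le> 1 / 4\<close>: the bracket in the
    lower tail is then at least \<open>3 / 4 - 2 * (4 / 3) * (3 / 32) = 1 / 2\<close>.\<close>
  moreover have "eventually (\<lambda>x::real. exp (- ((\<delta>)\<^sup>2 * ln x)) \<le> 3 / 32) at_top"
    using \<delta> by real_asymp
  \<comment> \<open>The summands come from truncation, upper tail and lower tail. The first uses
    \<open>L ^ 4 = 4 * (ln x)\<^sup>2\<close> and the level \<open>L / 16\<close>; 8/3 is the 2 of
    the two-sided bound times \<open>exp (1 / 4) \<le> 4 / 3\<close>.\<close>
  moreover have "eventually (\<lambda>x::real. \<kappa> * K * 16 ^ 4 / (4 * (ln x)\<^sup>2) + 8 / 3 * x powr (- 2 * \<delta>)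
      + exp (- (x powr (2 * \<delta>) / 2)) \<le> \<eta>) at_top"
  proof -
    have "((\<lambda>x::real. \<kappa> * K * 16 ^ 4 / (4 * (ln x)\<^sup>2) + 8 / 3 * x powr (- 2 * \<delta>)
      + exp (- (x powr (2 * \<delta>) / 2))) \<longlongrightarrow> 0) at_top" using \<delta> by real_asymp
    from order_tendstoD(2)[OF this \<eta>] show ?thesis by (rule eventually_mono) (rule less_imp_le)
  qed
  ultimately have "eventually (\<lambda>x. ?e x \<le> 1 / 2 \<and> ?d x \<le> 1 / 4 \<and> ?b x \<le> 1 \<and> exp (- ((\<delta>)\<^sup>2 * ln x)) \<le> 3 / 32
     \<and> \<kappa> * K * 16 ^ 4 / (4 * (ln x)\<^sup>2) + 8 / 3 * x powr (- 2 * \<delta>) + exp (- (x powr (2 * \<delta>) / 2)) \<le> \<eta>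
     \<and> 1 < x) at_top"
    using eventually_gt_at_top[of 1] by eventually_elim auto
  then have "eventually (\<lambda>n. ?e (real n) \<le> 1 / 2 \<and> ?d (real n) \<le> 1 / 4 \<and> ?b (real n) \<le> 1
     \<and> exp (- ((\<delta>)\<^sup>2 * ln (real n))) \<le> 3 / 32
     \<and> \<kappa> * K * 16 ^ 4 / (4 * (ln (real n))\<^sup>2) + 8 / 3 * real n powr (- 2 * \<delta>) + exp (- (real n powr (2 * \<delta>) / 2)) \<le> \<eta>
     \<and> 1 < real n) sequentially"
    by (rule eventually_compose_filterlim) (rule filterlim_real_sequentially)
  then obtain N where N: "\<And>r. N \<le> r \<Longrightarrow> ?e (real r) \<le> 1 / 2 \<and> ?d (real r) \<le> 1 / 4 \<and> ?b (real r) \<le> 1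
     \<and> exp (- ((\<delta>)\<^sup>2 * ln (real r))) \<le> 3 / 32
     \<and> \<kappa> * K * 16 ^ 4 / (4 * (ln (real r))\<^sup>2) + 8 / 3 * real r powr (- 2 * \<delta>) + exp (- (real r powr (2 * \<delta>) / 2)) \<le> \<eta>
     \<and> 1 < real r"
    unfolding eventually_sequentially by blast
  show ?thesis
  proof (intro exI[of _ N] allI impI)
    fix M :: "'a measure" and X r c and w :: "nat \<Rightarrow> real"
    assume sm: "standard_matrix M X r c \<kappa>" and r: "N \<le> r" and w2: "(\<Sum>j<c. (w j)\<^sup>2) = 1"
      and w4: "(\<Sum>j<c. w j ^ 4) \<le> K / real r"
    interpret standard_matrix M X r c \<kappa> by fact
    let ?L = "max_scale (real r)"
    note n = N[OF r]
    have r1: "1 < real r" using n by blast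
    have lnr: "0 < ln (real r)" using r1 by simp
    have Lsq: "?L\<^sup>2 = 2 * ln (real r)" using max_scale_power2[of "real r"] r1 by simp
    have L0: "0 < ?L" using lnr by (simp add: max_scale_def)
    \<comment> \<open>A single weight is at most the fourth root of the sum of all fourth
      powers.\<close>
    have wb: "\<bar>w j\<bar> \<le> ?b (real r)" if "j < c" for j
    proof -
      have "w j ^ 4 \<le> (\<Sum>j<c. w j ^ 4)" using that by (intro member_le_sum[of j "{..<c}" "\<lambda>j. w j ^ 4"]) auto
      also have "\<dots> \<le> K / real r" by (rule w4)
      also have "\<dots> = (?b (real r)) ^ 4" using K r1 by (simp add: powr_powr flip: powr_realpow)
      finally have "\<bar>w j\<bar> ^ 4 \<le> (?b (real r)) ^ 4" by (simp add: power_even_abs)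
      then show ?thesis by (rule power_le_imp_le_base[of _ 3, simplified]) simp
    qed
    have "prob {\<omega> \<in> space M. \<not> ((\<exists>i<r. (1 - 3 * \<delta>) * ?L \<le> \<bar>row_form w i \<omega>\<bar>)
      \<and> (\<forall>i<r. \<bar>row_form w i \<omega>\<bar> < (1 + \<delta>) * ?L))}
     \<le> real r * \<kappa> * (\<Sum>j<c. w j ^ 4) / (?L / 16) ^ 4
      + real r * (2 * exp (?d (real r) + ?L\<^sup>2 / 2 - ?L * ((1 + \<delta>) * ?L)))
      + exp (- (real r * (exp (- ((1 - 2 * \<delta>) * (?L\<^sup>2 / 2))) * (exp (- ?d (real r)) - 2 * exp (?d (real r) - (\<delta> * ?L)\<^sup>2 / 2)))))"
      by (rule max_row_form_tail[OF w2 wb]) (use n L0 \<delta> r1 in auto)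
    also have "\<dots> \<le> \<kappa> * K * 16 ^ 4 / (4 * (ln (real r))\<^sup>2) + 8 / 3 * real r powr (- 2 * \<delta>)
        + exp (- (real r powr (2 * \<delta>) / 2))"
    proof (intro add_mono)
      have L4: "?L ^ 4 = 4 * (ln (real r))\<^sup>2"
      proof -
        have "?L ^ 4 = (?L\<^sup>2)\<^sup>2" by simp
        then show ?thesis unfolding Lsq by (simp add: power_mult_distrib)
      qed
      have "real r * \<kappa> * (\<Sum>j<c. w j ^ 4) / (?L / 16) ^ 4 \<le> real r * \<kappa> * (K / real r) / (?L / 16) ^ 4"
        using w4 \<kappa>_nonneg by (intro divide_right_mono mult_left_mono) auto
      also have "\<dots> = \<kappa> * K * 16 ^ 4 / (4 * (ln (real r))\<^sup>2)"
        using r1 by (simp add: power_divide L4)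
      finally show "real r * \<kappa> * (\<Sum>j<c. w j ^ 4) / (?L / 16) ^ 4 \<le> \<kappa> * K * 16 ^ 4 / (4 * (ln (real r))\<^sup>2)" .
      have x: "real r * exp (- y * ln (real r)) = real r powr (1 - y)" for y
        using r1 by (simp add: powr_def exp_add left_diff_distrib exp_diff exp_minus field_simps)
      have "?d (real r) + ?L\<^sup>2 / 2 - ?L * ((1 + \<delta>) * ?L) = ?d (real r) + - (1 + 2 * \<delta>) * ln (real r)"
      proof -
        have "?L * ((1 + \<delta>) * ?L) = (1 + \<delta>) * ?L\<^sup>2" by (simp add: power2_eq_square)
        then show ?thesis by (simp add: Lsq algebra_simps)
      qed
      then have "real r * (2 * exp (?d (real r) + ?L\<^sup>2 / 2 - ?L * ((1 + \<delta>) * ?L)))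
         = 2 * exp (?d (real r)) * (real r * exp (- (1 + 2 * \<delta>) * ln (real r)))"
        by (simp only: exp_add) simp
      also have "\<dots> = 2 * exp (?d (real r)) * real r powr (- 2 * \<delta>)" unfolding x by simp
      also have "\<dots> \<le> 2 * (4 / 3) * real r powr (- 2 * \<delta>)"
      proof (intro mult_right_mono mult_left_mono)
        have "exp (?d (real r)) \<le> exp (1 / 4)" using n by simp
        then show "exp (?d (real r)) \<le> 4 / 3" using exp_quarter_bounds(2) by linarith
      qed auto
      finally show "real r * (2 * exp (?d (real r) + ?L\<^sup>2 / 2 - ?L * ((1 + \<delta>) * ?L))) \<le> 8 / 3 * real r powr (- 2 * \<delta>)"
        by simp
      have "1 / 2 \<le> exp (- ?d (real r)) - 2 * exp (?d (real r) - (\<delta> * ?L)\<^sup>2 / 2)"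
      proof -
        have "exp (- 1 / 4) \<le> exp (- ?d (real r))" using n by simp
        then have 1: "3 / 4 \<le> exp (- ?d (real r))" using exp_quarter_bounds(1) by linarith
        have "exp (?d (real r) - (\<delta> * ?L)\<^sup>2 / 2) = exp (?d (real r)) * exp (- (\<delta>\<^sup>2 * ln (real r)))"
          by (simp add: power_mult_distrib Lsq flip: exp_add)
        also have "\<dots> \<le> 4 / 3 * (3 / 32)"
        proof (intro mult_mono)
          have "exp (?d (real r)) \<le> exp (1 / 4)" using n by simp
          then show "exp (?d (real r)) \<le> 4 / 3" using exp_quarter_bounds(2) by linarith
        qed (use n in auto)
        finally show ?thesis using 1 by linarith
      qed
      then have "real r * exp (- ((1 - 2 * \<delta>) * (?L\<^sup>2 / 2))) * (1 / 2)
         \<le> real r * exp (- ((1 - 2 * \<delta>) * (?L\<^sup>2 / 2))) * (exp (- ?d (real r)) - 2 * exp (?d (real r) - (\<delta> * ?L)\<^sup>2 / 2))"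
        by (intro mult_left_mono) auto
      moreover have "real r * exp (- ((1 - 2 * \<delta>) * (?L\<^sup>2 / 2))) = real r powr (2 * \<delta>)"
      proof -
        have "- ((1 - 2 * \<delta>) * (?L\<^sup>2 / 2)) = - (1 - 2 * \<delta>) * ln (real r)"
          by (simp add: Lsq algebra_simps)
        then show ?thesis by (simp only: x) simp
      qed
      ultimately show "exp (- (real r * (exp (- ((1 - 2 * \<delta>) * (?L\<^sup>2 / 2))) * (exp (- ?d (real r)) - 2 * exp (?d (real r) - (\<delta> * ?L)\<^sup>2 / 2)))))
        \<le> exp (- (real r powr (2 * \<delta>) / 2))"
        by (simp add: mult.assoc)
    qed
    also have "\<dots> \<le> \<eta>" using n by blast
    finally show "prob {\<omega> \<in> space M. \<not> ((\<exists>i<r. (1 - 3 * \<delta>) * ?L \<le> \<bar>row_form w i \<omega>\<bar>)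
      \<and> (\<forall>i<r. \<bar>row_form w i \<omega>\<bar> < (1 + \<delta>) * ?L))} \<le> \<eta>" .
  qed
qed

section \<open>Conditioning on an independent vector\<close>

text \<open>By independence the joint law is a product, and Fubini integrates the probabilities of
  the sections of \<open>E\<close> over the law of \<open>V\<close>. Sections at values in
  \<open>G\<close> contribute at most \<open>d1\<close>; the others are bounded by 1 and carry mass
  at most \<open>d2\<close>.\<close>

lemma (in prob_space) indep_var_prob_le:
  assumes ind: "indep_var S X T V" and E: "E \<in> sets (S \<Otimes>\<^sub>M T)" and G: "G \<in> sets T"
    and d1: "0 \<le> d1" "\<And>v. v \<in> G \<Longrightarrow> prob {\<omega> \<in> space M. (X \<omega>, v) \<in> E} \<le> d1"
    and d2: "prob {\<omega> \<in> space M. V \<omega> \<notin> G} \<le> d2"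
  shows "prob {\<omega> \<in> space M. (X \<omega>, V \<omega>) \<in> E} \<le> d1 + d2"
proof -
  have X [measurable]: "X \<in> measurable M S" and V [measurable]: "V \<in> measurable M T"
    using indep_var_rv1[OF ind] indep_var_rv2[OF ind] by auto
  interpret X: prob_space "distr M S X" by (rule prob_space_distr) fact
  interpret V: prob_space "distr M T V" by (rule prob_space_distr) fact
  interpret XV: pair_prob_space "distr M S X" "distr M T V" ..
  have eq: "distr M S X \<Otimes>\<^sub>M distr M T V = distr M (S \<Otimes>\<^sub>M T) (\<lambda>x. (X x, V x))"
    using ind by (simp add: indep_var_distribution_eq)
  have "emeasure M {\<omega> \<in> space M. (X \<omega>, V \<omega>) \<in> E} = emeasure (distr M S X \<Otimes>\<^sub>M distr M T V) E"
    unfolding eq using E by (subst emeasure_distr) (auto intro!: arg_cong[of _ _ "emeasure M"])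
  also have "\<dots> = (\<integral>\<^sup>+ v. emeasure (distr M S X) ((\<lambda>x. (x, v)) -` E) \<partial>distr M T V)"
    using E by (intro XV.emeasure_pair_measure_alt2) simp
  also have "\<dots> \<le> (\<integral>\<^sup>+ v. ennreal d1 + indicator (space T - G) v \<partial>distr M T V)"
  proof (intro nn_integral_mono)
    fix v assume "v \<in> space (distr M T V)"
    then have v: "v \<in> space T" by simp
    have Ev: "(\<lambda>x. (x, v)) -` E \<in> sets S" using E by (rule sets_Pair2)
    show "emeasure (distr M S X) ((\<lambda>x. (x, v)) -` E) \<le> ennreal d1 + indicator (space T - G) v"
    proof (cases "v \<in> G")
      case True
      have "emeasure (distr M S X) ((\<lambda>x. (x, v)) -` E) = emeasure M {\<omega> \<in> space M. (X \<omega>, v) \<in> E}"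
        using Ev by (subst emeasure_distr) (auto intro!: arg_cong[of _ _ "emeasure M"])
      also have "\<dots> \<le> ennreal d1"
        using d1(2)[OF True] by (simp add: emeasure_eq_measure ennreal_leI)
      finally show ?thesis by (simp add: add_increasing2)
    next
      case False
      have "emeasure (distr M S X) ((\<lambda>x. (x, v)) -` E) \<le> 1" by (rule X.emeasure_le_1)
      then show ?thesis using False v by (simp add: add_increasing)
    qed
  qed
  also have "\<dots> = ennreal d1 + emeasure (distr M T V) (space T - G)"
    using G by (subst nn_integral_add) (auto simp: V.emeasure_space_1 simp del: space_distr)
  also have "emeasure (distr M T V) (space T - G) = emeasure M {\<omega> \<in> space M. V \<omega> \<notin> G}"
    using G measurable_space[OF V] by (subst emeasure_distr) (auto intro!: arg_cong[of _ _ "emeasure M"])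
  also have "\<dots> = ennreal (prob {\<omega> \<in> space M. V \<omega> \<notin> G})" by (simp add: emeasure_eq_measure)
  also have "ennreal d1 + ennreal (prob {\<omega> \<in> space M. V \<omega> \<notin> G}) \<le> ennreal d1 + ennreal d2"
    using d2 by (intro add_left_mono ennreal_leI)
  also have "\<dots> = ennreal (d1 + d2)"
    using d1(1) order_trans[OF measure_nonneg d2] by (simp add: ennreal_plus)
  finally have "ennreal (prob {\<omega> \<in> space M. (X \<omega>, V \<omega>) \<in> E}) \<le> ennreal (d1 + d2)"
    by (simp only: emeasure_eq_measure)
  then show ?thesis
    using d1(1) order_trans[OF measure_nonneg d2] by (subst (asm) ennreal_le_iff) simp_all
qed

section \<open>Balanced vectors and their images under one factor\<close>

abbreviation real_vec :: "nat \<Rightarrow> (nat \<Rightarrow> real) measure" where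
  "real_vec d \<equiv> PiM {..<d} (\<lambda>_. borel)"

abbreviation real_array :: "nat \<Rightarrow> nat \<Rightarrow> (nat \<times> nat \<Rightarrow> real) measure" where
  "real_array r c \<equiv> PiM ({..<r} \<times> {..<c}) (\<lambda>_. borel)"

lemma measurable_real_vec [measurable]: "i < d \<Longrightarrow> (\<lambda>v. v i) \<in> borel_measurable (real_vec d)"
  by (rule measurable_component_singleton) simp

text \<open>\<open>N\<close> is the anticipated squared norm. If the mass is spread evenly, each
  squared entry is \<open>N / d\<close> and the fourth powers sum to \<open>N\<^sup>2 / d\<close>;
  hence \<open>K\<close> measures the deviation from an even spread.\<close>

definition balanced_vecs :: "nat \<Rightarrow> real \<Rightarrow> real \<Rightarrow> real \<Rightarrow> (nat \<Rightarrow> real) set" where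
  "balanced_vecs d N e K = {v \<in> space (real_vec d).
     \<bar>(\<Sum>j<d. (v j)\<^sup>2) / N - 1\<bar> < e \<and> (\<Sum>j<d. v j ^ 4) < K * N\<^sup>2 / real d}"

text \<open>The bounds on the largest absolute value are phrased by quantifiers, which exhibits the
  set as a finite combination of coordinate conditions.\<close>

definition sup_between :: "nat \<Rightarrow> real \<Rightarrow> real \<Rightarrow> (nat \<Rightarrow> real) set" where
  "sup_between d a b = {v \<in> space (real_vec d). (\<exists>i<d. a \<le> \<bar>v i\<bar>) \<and> (\<forall>i<d. \<bar>v i\<bar> < b)}"

lemma balanced_vecs_sets: "balanced_vecs d N e K \<in> sets (real_vec d)"
proof -
  have [measurable]: "(\<lambda>v. \<Sum>j<d. (v j)\<^sup>2) \<in> borel_measurable (real_vec d)"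
    "(\<lambda>v. \<Sum>j<d. v j ^ 4) \<in> borel_measurable (real_vec d)"
    by (intro borel_measurable_sum borel_measurable_power measurable_real_vec; simp)+
  show ?thesis unfolding balanced_vecs_def by measurable
qed

lemma sup_between_sets: "sup_between d a b \<in> sets (real_vec d)"
proof -
  have m: "{v \<in> space (real_vec d). a \<le> \<bar>v i\<bar>} \<in> sets (real_vec d)"
    "{v \<in> space (real_vec d). b \<le> \<bar>v i\<bar>} \<in> sets (real_vec d)" if "i < d" for i
    using measurable_real_vec[OF that] by measurable
  have "sup_between d a b = (\<Union>i<d. {v \<in> space (real_vec d). a \<le> \<bar>v i\<bar>})
      - (\<Union>i<d. {v \<in> space (real_vec d). b \<le> \<bar>v i\<bar>})"
    by (auto simp: sup_between_def not_le)
  also have "\<dots> \<in> sets (real_vec d)" using m by (intro sets.Diff sets.finite_UN) auto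
  finally show ?thesis .
qed

context standard_matrix
begin

text \<open>
  \<^const>\<open>indep_var\<close> relates two variables of the same type only, so the matrix and the vector are
  obtained as functions \<open>f\<close> and \<open>g\<close> of independent families \<open>Y\<close> and \<open>Z\<close>.
\<close>
lemma random_row_forms_prob_le:
  assumes ind: "indep_var S Y T Z"
    and f: "f \<in> measurable S (real_array r c)" and g: "g \<in> measurable T (real_vec c)"
    and fY: "\<And>\<omega>. \<omega> \<in> space M \<Longrightarrow> f (Y \<omega>) = restrict (\<lambda>ij. X ij \<omega>) ({..<r} \<times> {..<c})"
    and F: "F \<in> sets (real_vec r)" and G: "G \<in> sets (real_vec c)"
    and d1: "0 \<le> d1" "\<And>v. v \<in> G \<Longrightarrow> prob {\<omega> \<in> space M. (\<lambda>i\<in>{..<r}. row_form v i \<omega>) \<notin> F} \<le> d1"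
    and d2: "prob {\<omega> \<in> space M. g (Z \<omega>) \<notin> G} \<le> d2"
  shows "prob {\<omega> \<in> space M. (\<lambda>i\<in>{..<r}. row_form (g (Z \<omega>)) i \<omega>) \<notin> F} \<le> d1 + d2"
proof -
  let ?h = "\<lambda>z. \<lambda>i\<in>{..<r}. \<Sum>j<c. f (fst z) (i, j) * g (snd z) j"
  have h: "?h \<in> measurable (S \<Otimes>\<^sub>M T) (real_vec r)"
  proof (intro measurable_restrict borel_measurable_sum borel_measurable_times)
    fix i j assume "i \<in> {..<r}" "j \<in> {..<c}"
    then show "(\<lambda>z. f (fst z) (i, j)) \<in> borel_measurable (S \<Otimes>\<^sub>M T)"
      "(\<lambda>z. g (snd z) j) \<in> borel_measurable (S \<Otimes>\<^sub>M T)"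
      by (auto intro!: measurable_compose[OF measurable_fst] measurable_compose[OF measurable_snd]
        measurable_compose[OF f measurable_component_singleton]
        measurable_compose[OF g measurable_component_singleton])
  qed
  let ?E = "{z \<in> space (S \<Otimes>\<^sub>M T). ?h z \<notin> F}"
  have E: "?E \<in> sets (S \<Otimes>\<^sub>M T)"
  proof -
    have "?E = space (S \<Otimes>\<^sub>M T) - (?h -` F \<inter> space (S \<Otimes>\<^sub>M T))" by auto
    then show ?thesis using measurable_sets[OF h F] by auto
  qed
  have G': "g -` G \<inter> space T \<in> sets T" using g G by (rule measurable_sets)
  have Ysp: "Y \<omega> \<in> space S" if "\<omega> \<in> space M" for \<omega>
    using measurable_space[OF indep_var_rv1[OF ind] that] .
  have Zsp: "Z \<omega> \<in> space T" if "\<omega> \<in> space M" for \<omega>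
    using measurable_space[OF indep_var_rv2[OF ind] that] .
  have hX: "?h (Y \<omega>, z) = (\<lambda>i\<in>{..<r}. row_form (g z) i \<omega>)" if "\<omega> \<in> space M" for \<omega> z
    using fY[OF that] by (auto simp: row_form_def fun_eq_iff restrict_def intro!: sum.cong)
  have "prob {\<omega> \<in> space M. (Y \<omega>, Z \<omega>) \<in> ?E} \<le> d1 + d2"
  proof (rule indep_var_prob_le[OF ind E G' d1(1)])
    fix z assume z: "z \<in> g -` G \<inter> space T"
    have "{\<omega> \<in> space M. (Y \<omega>, z) \<in> ?E} = {\<omega> \<in> space M. (\<lambda>i\<in>{..<r}. row_form (g z) i \<omega>) \<notin> F}"
      using Ysp z hX by (auto simp: space_pair_measure)
    then show "prob {\<omega> \<in> space M. (Y \<omega>, z) \<in> ?E} \<le> d1" using d1(2)[of "g z"] z by simp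
  next
    have "{\<omega> \<in> space M. Z \<omega> \<notin> g -` G \<inter> space T} = {\<omega> \<in> space M. g (Z \<omega>) \<notin> G}"
      using Zsp by auto
    then show "prob {\<omega> \<in> space M. Z \<omega> \<notin> g -` G \<inter> space T} \<le> d2" using d2 by simp
  qed
  moreover have "{\<omega> \<in> space M. (Y \<omega>, Z \<omega>) \<in> ?E} = {\<omega> \<in> space M. (\<lambda>i\<in>{..<r}. row_form (g (Z \<omega>)) i \<omega>) \<notin> F}"
    using Ysp Zsp hX by (auto simp: space_pair_measure)
  ultimately show ?thesis by simp
qed

text \<open>Two relative errors \<open>e\<close>, the old one of \<open>s / N\<close> and the new
  one of the squared norm over \<open>r * s\<close>, combine to at most \<open>3 * e\<close> when
  \<open>e \<le> 1 / 3\<close>. The spread is controlled afresh through the randomness of this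
  factor: Markov supplies \<open>K\<close>, and \<open>s < 2 * N\<close> turns it into
  \<open>4 * K\<close>.\<close>

lemma row_forms_balanced:
  assumes v: "v \<in> balanced_vecs c N e K'" and N: "0 < N" and e: "0 < e" "e \<le> 1 / 3" and K: "0 < K" and r: "0 < r"
  shows "prob {\<omega> \<in> space M. (\<lambda>i\<in>{..<r}. row_form v i \<omega>) \<notin> balanced_vecs r (real r * N) (3 * e) (4 * K)}
     \<le> (3 + \<kappa>) / (real r * e\<^sup>2) + (3 + \<kappa>) / K"
proof -
  define s where "s = (\<Sum>j<c. (v j)\<^sup>2)"
  have sN: "\<bar>s / N - 1\<bar> < e" using v by (simp add: balanced_vecs_def s_def)
  then have sN': "1 - e < s / N" "s / N < 1 + e" by linarith+
  have s0: "0 < s"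
  proof -
    have "0 < s / N" using sN'(1) e by linarith
    then show ?thesis using N by (simp add: zero_less_divide_iff)
  qed
  let ?B1 = "{\<omega> \<in> space M. e \<le> \<bar>(\<Sum>i<r. (row_form v i \<omega>)\<^sup>2) / (real r * s) - 1\<bar>}"
  let ?B2 = "{\<omega> \<in> space M. K * real r * s\<^sup>2 \<le> (\<Sum>i<r. row_form v i \<omega> ^ 4)}"
  have [measurable]: "(\<lambda>\<omega>. \<Sum>i<r. (row_form v i \<omega>) ^ k) \<in> borel_measurable M" for k
    by (intro borel_measurable_sum borel_measurable_power row_form_measurable) simp
  have B: "?B1 \<in> events" "?B2 \<in> events" by measurable
  have sub: "{\<omega> \<in> space M. (\<lambda>i\<in>{..<r}. row_form v i \<omega>) \<notin> balanced_vecs r (real r * N) (3 * e) (4 * K)} \<subseteq> ?B1 \<union> ?B2"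
  proof (rule subsetI, rule ccontr)
    fix \<omega> assume a: "\<omega> \<in> {\<omega> \<in> space M. (\<lambda>i\<in>{..<r}. row_form v i \<omega>) \<notin> balanced_vecs r (real r * N) (3 * e) (4 * K)}"
      and nb: "\<omega> \<notin> ?B1 \<union> ?B2"
    define Q where "Q = (\<Sum>i<r. (row_form v i \<omega>)\<^sup>2)"
    have q: "\<bar>Q / (real r * s) - 1\<bar> < e" and f: "(\<Sum>i<r. row_form v i \<omega> ^ 4) < K * real r * s\<^sup>2"
      using a nb by (auto simp: Q_def)
    have q': "1 - e < Q / (real r * s)" "Q / (real r * s) < 1 + e" using abs_diff_less_iff[THEN iffD1, OF q] by blast+
    have Qeq: "Q / (real r * N) = (Q / (real r * s)) * (s / N)" using s0 N r by simp
    have "(Q / (real r * s)) * (s / N) \<le> (1 + e) * (1 + e)"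
      using q' sN' e by (intro mult_mono) auto
    also have "\<dots> < 1 + 3 * e"
    proof -
      have "e * e < e * 1" using e by (intro mult_strict_left_mono) auto
      then show ?thesis by (simp add: algebra_simps)
    qed
    finally have 1: "Q / (real r * N) < 1 + 3 * e" unfolding Qeq .
    have "1 - 3 * e < (1 - e) * (1 - e)" using e by (simp add: algebra_simps add_pos_nonneg)
    also have "\<dots> \<le> (Q / (real r * s)) * (s / N)"
      using q' sN' e by (intro mult_mono) auto
    finally have 2: "1 - 3 * e < Q / (real r * N)" unfolding Qeq .
    have "s / N < 2" using sN'(2) e by linarith
    then have "s < 2 * N" using N by (simp add: pos_divide_less_eq)
    then have "s\<^sup>2 \<le> (2 * N)\<^sup>2" using s0 by (intro power_mono) auto
    then have "K * real r * s\<^sup>2 \<le> K * real r * (2 * N)\<^sup>2" using K by (intro mult_left_mono) auto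
    also have "\<dots> = 4 * K * (real r * N)\<^sup>2 / real r" using r by (simp add: power2_eq_square)
    finally have 3: "(\<Sum>i<r. row_form v i \<omega> ^ 4) < 4 * K * (real r * N)\<^sup>2 / real r" using f by linarith
    have "\<bar>Q / (real r * N) - 1\<bar> < 3 * e" by (rule abs_diff_less_iff[THEN iffD2, OF conjI[OF 2 1]])
    then have "(\<lambda>i\<in>{..<r}. row_form v i \<omega>) \<in> balanced_vecs r (real r * N) (3 * e) (4 * K)"
      using 3 by (simp add: balanced_vecs_def space_PiM Q_def)
    then show False using a by blast
  qed
  have "prob {\<omega> \<in> space M. (\<lambda>i\<in>{..<r}. row_form v i \<omega>) \<notin> balanced_vecs r (real r * N) (3 * e) (4 * K)} \<le> prob (?B1 \<union> ?B2)"
    using sub B by (intro finite_measure_mono) auto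
  also have "\<dots> \<le> prob ?B1 + prob ?B2" using B by (rule measure_Un_le)
  also have "\<dots> \<le> (3 + \<kappa>) / (real r * e\<^sup>2) + (3 + \<kappa>) / K"
    by (intro add_mono row_form_norm_concentration row_form_fourth_power_bound s_def s0 e K r)
  finally show ?thesis .
qed

end

text \<open>Reduction to the unit vector \<open>w = v / sqrt s\<close>. Since \<open>s / N\<close>
  lies within \<open>\<delta>\<close> of 1, so does its square root, which widens the margins from
  \<open>3 * \<delta>\<close> and \<open>\<delta>\<close> to \<open>4 * \<delta>\<close> and
  \<open>3 * \<delta>\<close>. With \<open>N \<le> 2 * s\<close>, the spread of \<open>v\<close>
  bounds the fourth powers of \<open>w\<close> by \<open>4 * K / c\<close>, and
  \<open>r \<le> C * c\<close> expresses this in terms of the number of rows.\<close>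

lemma max_row_form_asymp:
  fixes K \<kappa> \<delta> \<eta> C :: real
  assumes K: "0 < K" and C: "0 < C" and \<delta>: "0 < \<delta>" "\<delta> \<le> 1 / 8" and \<eta>: "0 < \<eta>"
  shows "\<exists>N0. \<forall>(M :: 'a measure) X r c v N. standard_matrix M X r c \<kappa> \<longrightarrow> N0 \<le> r \<longrightarrow> 0 < c \<longrightarrow>
     real r \<le> C * real c \<longrightarrow> 0 < N \<longrightarrow> v \<in> balanced_vecs c N \<delta> K \<longrightarrow>
     measure M {\<omega> \<in> space M. (\<lambda>i\<in>{..<r}. standard_matrix.row_form X c v i \<omega>)
        \<notin> sup_between r ((1 - 4 * \<delta>) * sqrt (2 * N * ln (real r))) ((1 + 3 * \<delta>) * sqrt (2 * N * ln (real r)))} \<le> \<eta>"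
proof -
  have K': "0 < 4 * K * C" using K C by simp
  have \<delta>': "\<delta> \<le> 1 / 2" using \<delta> by simp
  obtain N0 where N0: "\<And>(M :: 'a measure) X r c w. standard_matrix M X r c \<kappa> \<Longrightarrow> N0 \<le> r \<Longrightarrow>
     (\<Sum>j<c. (w j)\<^sup>2) = 1 \<Longrightarrow> (\<Sum>j<c. w j ^ 4) \<le> 4 * K * C / real r \<Longrightarrow>
     measure M {\<omega> \<in> space M. \<not> ((\<exists>i<r. (1 - 3 * \<delta>) * max_scale (real r) \<le> \<bar>standard_matrix.row_form X c w i \<omega>\<bar>)
      \<and> (\<forall>i<r. \<bar>standard_matrix.row_form X c w i \<omega>\<bar> < (1 + \<delta>) * max_scale (real r)))} \<le> \<eta>"
    using max_row_form_tail_asymp[OF K' \<delta>(1) \<delta>' \<eta>, of \<kappa>, where 'a = 'a] by blast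
  show ?thesis
  proof (intro exI[of _ "max N0 1"] allI impI)
    fix M :: "'a measure" and X r c and v :: "nat \<Rightarrow> real" and N :: real
    assume sm: "standard_matrix M X r c \<kappa>" and r: "max N0 1 \<le> r" and c: "0 < c"
      and rc: "real r \<le> C * real c" and N: "0 < N" and v: "v \<in> balanced_vecs c N \<delta> K"
    interpret standard_matrix M X r c \<kappa> by fact
    define s where "s = (\<Sum>j<c. (v j)\<^sup>2)"
    have "\<bar>s / N - 1\<bar> < \<delta>" using v by (simp add: balanced_vecs_def s_def)
    then have sN: "1 - \<delta> < s / N" "s / N < 1 + \<delta>" by linarith+
    have s0: "0 < s"
    proof -
      have "0 < s / N" using sN(1) \<delta> by linarith
      then show ?thesis using N by (simp add: zero_less_divide_iff)
    qed
    define w where "w j = v j / sqrt s" for j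
    have w2: "(\<Sum>j<c. (w j)\<^sup>2) = 1"
      using s0 by (simp add: w_def power_divide s_def[symmetric] flip: sum_divide_distrib)
    have w4: "(\<Sum>j<c. w j ^ 4) \<le> 4 * K * C / real r"
    proof -
      have s4: "sqrt s ^ 4 = s\<^sup>2"
      proof -
        have "sqrt s ^ 4 = ((sqrt s)\<^sup>2)\<^sup>2" by simp
        then show ?thesis using s0 by simp
      qed
      have "N \<le> 2 * s"
      proof -
        have "1 / 2 \<le> s / N" using sN(1) \<delta> by linarith
        then show ?thesis using N by (simp add: field_simps)
      qed
      then have Ns: "N\<^sup>2 \<le> 4 * s\<^sup>2" using power_mono[of N "2 * s" 2] N by (simp add: power_mult_distrib)
      have "(\<Sum>j<c. w j ^ 4) = (\<Sum>j<c. v j ^ 4) / s\<^sup>2"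
        by (simp add: w_def power_divide s4 sum_divide_distrib)
      also have "\<dots> \<le> (K * N\<^sup>2 / real c) / s\<^sup>2"
        using v by (intro divide_right_mono) (auto simp: balanced_vecs_def)
      also have "\<dots> \<le> (K * (4 * s\<^sup>2) / real c) / s\<^sup>2"
        using Ns K by (intro divide_right_mono mult_left_mono) auto
      also have "\<dots> = 4 * K / real c" using s0 by simp
      also have "\<dots> \<le> 4 * K * C / real r"
        using rc c r K by (simp add: field_simps) 
      finally show ?thesis .
    qed
    have rv: "row_form v i \<omega> = sqrt s * row_form w i \<omega>" for i \<omega>
      using s0 by (simp add: row_form_def w_def sum_distrib_left)
    let ?L = "max_scale (real r)"
    let ?G = "\<lambda>\<omega>. (\<exists>i<r. (1 - 3 * \<delta>) * ?L \<le> \<bar>row_form w i \<omega>\<bar>) \<and> (\<forall>i<r. \<bar>row_form w i \<omega>\<bar> < (1 + \<delta>) * ?L)"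
    let ?F = "sup_between r ((1 - 4 * \<delta>) * sqrt (2 * N * ln (real r))) ((1 + 3 * \<delta>) * sqrt (2 * N * ln (real r)))"
    have L0: "0 \<le> ?L" using r by (simp add: max_scale_def)
    have LN: "sqrt (2 * N * ln (real r)) = sqrt N * ?L"
      using N by (simp add: max_scale_def real_sqrt_mult)
    have ss: "sqrt s = sqrt (s / N) * sqrt N" using N by (simp add: real_sqrt_divide)
    have sl: "1 - \<delta> \<le> sqrt (s / N)"
    proof (rule real_le_rsqrt)
      have "(1 - \<delta>) * (1 - \<delta>) \<le> (1 - \<delta>) * 1" using \<delta> by (intro mult_left_mono) auto
      then show "(1 - \<delta>)\<^sup>2 \<le> s / N" using sN by (simp add: power2_eq_square)
    qed
    have su: "sqrt (s / N) \<le> 1 + \<delta>"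
    proof (rule real_le_lsqrt)
      have "1 + \<delta> \<le> (1 + \<delta>)\<^sup>2" using \<delta> by (simp add: power2_eq_square algebra_simps)
      then show "s / N \<le> (1 + \<delta>)\<^sup>2" using sN by linarith
    qed (use \<delta> s0 N in auto)
    have lo: "(1 - 4 * \<delta>) * sqrt (2 * N * ln (real r)) \<le> sqrt s * ((1 - 3 * \<delta>) * ?L)"
    proof -
      have "(1 - 4 * \<delta>) \<le> (1 - \<delta>) * (1 - 3 * \<delta>)" using \<delta> by (simp add: algebra_simps)
      also have "\<dots> \<le> sqrt (s / N) * (1 - 3 * \<delta>)" using sl \<delta> by (intro mult_right_mono) auto
      finally have "(1 - 4 * \<delta>) * (sqrt N * ?L) \<le> sqrt (s / N) * (1 - 3 * \<delta>) * (sqrt N * ?L)"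
        using L0 N by (intro mult_right_mono) auto
      then show ?thesis unfolding LN ss by (simp add: mult_ac)
    qed
    have hi: "sqrt s * ((1 + \<delta>) * ?L) \<le> (1 + 3 * \<delta>) * sqrt (2 * N * ln (real r))"
    proof -
      have "sqrt (s / N) * (1 + \<delta>) \<le> (1 + \<delta>) * (1 + \<delta>)" using su \<delta> by (intro mult_right_mono) auto
      also have "\<dots> \<le> 1 + 3 * \<delta>"
      proof -
        have "\<delta> * \<delta> \<le> \<delta> * 1" using \<delta> by (intro mult_left_mono) auto
        then show ?thesis by (simp add: algebra_simps)
      qed
      finally have "sqrt (s / N) * (1 + \<delta>) * (sqrt N * ?L) \<le> (1 + 3 * \<delta>) * (sqrt N * ?L)"
        using L0 N by (intro mult_right_mono) auto
      then show ?thesis unfolding LN ss by (simp add: mult_ac)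
    qed
    have in_F: "(\<lambda>i\<in>{..<r}. row_form v i \<omega>) \<in> ?F" if G: "?G \<omega>" for \<omega>
    proof -
      have abs: "\<bar>row_form v i \<omega>\<bar> = sqrt s * \<bar>row_form w i \<omega>\<bar>" for i
        unfolding rv using s0 by (simp add: abs_mult)
      obtain i where i: "i < r" "(1 - 3 * \<delta>) * ?L \<le> \<bar>row_form w i \<omega>\<bar>" using G by blast
      have "sqrt s * ((1 - 3 * \<delta>) * ?L) \<le> \<bar>row_form v i \<omega>\<bar>"
        unfolding abs using i(2) s0 by (intro mult_left_mono) auto
      then have 1: "(1 - 4 * \<delta>) * sqrt (2 * N * ln (real r)) \<le> \<bar>row_form v i \<omega>\<bar>" using lo by linarith
      have 2: "\<bar>row_form v i \<omega>\<bar> < (1 + 3 * \<delta>) * sqrt (2 * N * ln (real r))" if "i < r" for i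
      proof -
        have "\<bar>row_form v i \<omega>\<bar> < sqrt s * ((1 + \<delta>) * ?L)"
          unfolding abs using G that s0 by (intro mult_strict_left_mono) auto
        then show ?thesis using hi by linarith
      qed
      show ?thesis using 1 2 i(1) by (auto simp: sup_between_def space_PiM)
    qed
    have meas: "{\<omega> \<in> space M. \<not> ?G \<omega>} \<in> events"
    proof -
      have m: "{\<omega> \<in> space M. a \<le> \<bar>row_form w i \<omega>\<bar>} \<in> events"
        "{\<omega> \<in> space M. \<not> \<bar>row_form w i \<omega>\<bar> < a} \<in> events" if "i < r" for i a
        using row_form_measurable[OF that, of w] by measurable
      have "{\<omega> \<in> space M. \<not> ?G \<omega>} = (space M - (\<Union>i<r. {\<omega> \<in> space M. (1 - 3 * \<delta>) * ?L \<le> \<bar>row_form w i \<omega>\<bar>}))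
         \<union> (\<Union>i<r. {\<omega> \<in> space M. \<not> \<bar>row_form w i \<omega>\<bar> < (1 + \<delta>) * ?L})"
        by blast
      also have "\<dots> \<in> events" using m by (intro sets.Un sets.Diff sets.finite_UN sets.top) auto
      finally show ?thesis .
    qed
    have "prob {\<omega> \<in> space M. (\<lambda>i\<in>{..<r}. row_form v i \<omega>) \<notin> ?F} \<le> prob {\<omega> \<in> space M. \<not> ?G \<omega>}"
      by (rule finite_measure_mono[OF _ meas]) (use in_F in blast)
    also have "\<dots> \<le> \<eta>" by (rule N0[OF sm _ w2 w4]) (use r in auto)
    finally show "prob {\<omega> \<in> space M. (\<lambda>i\<in>{..<r}. row_form v i \<omega>) \<notin> ?F} \<le> \<eta>" .
  qed
qed

section \<open>Products of random matrices\<close>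

text \<open>
  \<open>iter_rows p n a k\<close> is the vector \<open>a (p - k + 1) * \<dots> * a p * 1\<close> of length \<open>n (p - k)\<close>.
\<close>
primrec iter_rows :: "nat \<Rightarrow> (nat \<Rightarrow> nat) \<Rightarrow> (nat \<Rightarrow> nat \<times> nat \<Rightarrow> real) \<Rightarrow> nat \<Rightarrow> nat \<Rightarrow> real" where
  "iter_rows p n a 0 = (\<lambda>_. 1)"
| "iter_rows p n a (Suc k) = (\<lambda>i. \<Sum>j<n (p - k). a (p - k) (i, j) * iter_rows p n a k j)"

text \<open>Measurability as a function of the factors themselves, not of the sample point:
  conditioning treats the vector as a function of the block of factors it is built from.\<close>

lemma iter_rows_measurable:
  assumes "k \<le> p" "{p - k<..p} \<subseteq> I" "i < n (p - k)"
  shows "(\<lambda>a. iter_rows p n a k i) \<in> borel_measurable (PiM I (\<lambda>q. real_array (n (q - 1)) (n q)))"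
  using assms
proof (induction k arbitrary: i)
  case (Suc k)
  have q: "p - k \<in> I" using Suc.prems by auto
  have m: "(\<lambda>a. a (p - k) (i, j)) \<in> borel_measurable (PiM I (\<lambda>q. real_array (n (q - 1)) (n q)))"
    if "j < n (p - k)" for j
    using Suc.prems(3) that
    by (intro measurable_compose[OF measurable_component_singleton[OF q] measurable_component_singleton]) simp
  have "(\<lambda>a. iter_rows p n a k j) \<in> borel_measurable (PiM I (\<lambda>q. real_array (n (q - 1)) (n q)))"
    if "j < n (p - k)" for j
  proof (rule Suc.IH)
    show "{p - k<..p} \<subseteq> I" by (rule subset_trans[OF _ Suc.prems(2)]) auto
  qed (use Suc.prems that in auto)
  then show ?case using m by (auto intro!: borel_measurable_sum borel_measurable_times)
qed simp

lemma iter_rows_borel_measurable: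
  assumes "\<And>q i j. q \<in> {1..p} \<Longrightarrow> i < n (q - 1) \<Longrightarrow> j < n q \<Longrightarrow> (\<lambda>\<omega>. a \<omega> q (i, j)) \<in> borel_measurable M"
    and "k \<le> p" "i < n (p - k)"
  shows "(\<lambda>\<omega>. iter_rows p n (a \<omega>) k i) \<in> borel_measurable M"
  using assms(2,3)
proof (induction k arbitrary: i)
  case (Suc k)
  have "(\<lambda>\<omega>. iter_rows p n (a \<omega>) k j) \<in> borel_measurable M" if "j < n (p - k)" for j
    by (rule Suc.IH) (use Suc.prems that in auto)
  moreover have "(\<lambda>\<omega>. a \<omega> (p - k) (i, j)) \<in> borel_measurable M" if "j < n (p - k)" for j
    by (rule assms(1)) (use Suc.prems that in auto)
  ultimately show ?case by (auto intro!: borel_measurable_sum borel_measurable_times)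
qed simp

text \<open>Only the last \<open>k\<close> factors, and only their entries within the dimensions,
  are read. This lets the random arrays be replaced by restrictions that are undefined
  elsewhere.\<close>

lemma iter_rows_cong:
  assumes "k \<le> p" "i < n (p - k)"
    and "\<And>q i j. q \<in> {p - k<..p} \<Longrightarrow> i < n (q - 1) \<Longrightarrow> j < n q \<Longrightarrow> a q (i, j) = b q (i, j)"
  shows "iter_rows p n a k i = iter_rows p n b k i"
  using assms
proof (induction k arbitrary: i)
  case (Suc k)
  have "iter_rows p n a k j = iter_rows p n b k j" if "j < n (p - k)" for j
    by (rule Suc.IH) (use Suc.prems that in auto)
  moreover have "a (p - k) (i, j) = b (p - k) (i, j)" if "j < n (p - k)" for j
    by (rule Suc.prems(3)) (use Suc.prems(1,2) that in auto)
  ultimately show ?case by (auto intro!: sum.cong)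
qed simp

lemma mat_prod_carrier:
  assumes "\<And>q. q \<in> {1..k} \<Longrightarrow> B q \<in> carrier_mat (n (q - 1)) (n q)"
  shows "mat_prod (n 0) B k \<in> carrier_mat (n 0) (n k)"
  using assms
proof (induction k)
  case (Suc k)
  have "mat_prod (n 0) B k \<in> carrier_mat (n 0) (n k)" by (rule Suc.IH) (use Suc.prems in auto)
  moreover have "B (Suc k) \<in> carrier_mat (n k) (n (Suc k))" using Suc.prems[of "Suc k"] by simp
  ultimately show ?case by simp
qed simp

text \<open>Associativity, one factor at a time: \<open>mat_prod\<close> grows on the right, and
  each step hands its last factor over to \<open>iter_rows\<close>. At \<open>k = p\<close> only the
  identity is left of the product.\<close>

lemma mat_prod_row_sum:
  assumes B: "\<And>q. q \<in> {1..p} \<Longrightarrow> B q \<in> carrier_mat (n (q - 1)) (n q)"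
    and i: "i < n 0" and "k \<le> p"
  shows "(\<Sum>j<n p. mat_prod (n 0) B p $$ (i, j))
    = (\<Sum>j<n (p - k). mat_prod (n 0) B (p - k) $$ (i, j) * iter_rows p n (\<lambda>q ij. B q $$ ij) k j)"
  using \<open>k \<le> p\<close>
proof (induction k)
  case (Suc k)
  define q where "q = p - Suc k"
  have q: "p - k = Suc q" "Suc q \<le> p" using Suc.prems by (auto simp: q_def)
  have C: "mat_prod (n 0) B q \<in> carrier_mat (n 0) (n q)"
    by (rule mat_prod_carrier) (use B q in auto)
  have D: "B (Suc q) \<in> carrier_mat (n q) (n (Suc q))" using B[of "Suc q"] q by simp
  have e: "mat_prod (n 0) B (Suc q) $$ (i, j) = (\<Sum>l<n q. mat_prod (n 0) B q $$ (i, l) * B (Suc q) $$ (l, j))"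
    if "j < n (Suc q)" for j
    using C D i that by (auto simp: scalar_prod_def lessThan_atLeast0 intro!: sum.cong)
  let ?v = "iter_rows p n (\<lambda>q ij. B q $$ ij) k"
  have "(\<Sum>j<n p. mat_prod (n 0) B p $$ (i, j)) = (\<Sum>j<n (Suc q). mat_prod (n 0) B (Suc q) $$ (i, j) * ?v j)"
    using Suc q by simp
  also have "\<dots> = (\<Sum>j<n (Suc q). \<Sum>l<n q. mat_prod (n 0) B q $$ (i, l) * (B (Suc q) $$ (l, j) * ?v j))"
    by (intro sum.cong refl, subst e) (auto simp: sum_distrib_right mult.assoc)
  also have "\<dots> = (\<Sum>l<n q. mat_prod (n 0) B q $$ (i, l) * iter_rows p n (\<lambda>q ij. B q $$ ij) (Suc k) l)"
    by (subst sum.swap) (simp add: sum_distrib_left q(1))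
  finally show ?case by (simp add: q_def)
qed simp

text \<open>All \<open>m\<close> entries of a row of the product with the ones matrix coincide, so
  each absolute row sum carries a factor \<open>m\<close> that cancels against the normalization.
  The right-hand side is free of \<open>m\<close>, which also yields the independence of
  \<open>m\<close>.\<close>

lemma normalized_ones_norm_eq:
  assumes B: "\<And>q. q \<in> {1..p} \<Longrightarrow> B q \<in> carrier_mat (n (q - 1)) (n q)"
    and n0: "1 \<le> n 0" and m: "1 \<le> m"
  shows "normalized_ones_norm p n m B = (2 * (\<Prod>q=1..p. real (n q)) * ln (real (n 0))) powr (- 1 / 2)
     * Max ((\<lambda>i. \<bar>iter_rows p n (\<lambda>q ij. B q $$ ij) p i\<bar>) ` {..<n 0})"
proof -
  let ?P = "mat_prod (n 0) B p" and ?v = "iter_rows p n (\<lambda>q ij. B q $$ ij) p"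
  have P: "?P \<in> carrier_mat (n 0) (n p)" by (rule mat_prod_carrier) fact
  have ones: "ones_mat (n p) m \<in> carrier_mat (n p) m" by (simp add: ones_mat_def)
  have "(?P * ones_mat (n p) m) $$ (i, j) = ?v i" if ij: "i < n 0" "j < m" for i j
  proof -
    have "(?P * ones_mat (n p) m) $$ (i, j) = (\<Sum>l<n p. ?P $$ (i, l))"
      using P ones ij by (auto simp: ones_mat_def scalar_prod_def lessThan_atLeast0 intro!: sum.cong)
    also have "\<dots> = (\<Sum>j<n 0. 1\<^sub>m (n 0) $$ (i, j) * ?v j)"
      using mat_prod_row_sum[OF B ij(1) order_refl] by simp
    also have "\<dots> = (\<Sum>j<n 0. if j = i then ?v j else 0)"
      using ij by (intro sum.cong) auto
    also have "\<dots> = ?v i" using ij by simp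
    finally show ?thesis .
  qed
  then have "linf_op_norm (?P * ones_mat (n p) m) = Max ((\<lambda>i. real m * \<bar>?v i\<bar>) ` {..<n 0})"
    using linf_op_norm_eq_Max_row_sum[OF mult_carrier_mat[OF P ones] n0 m] by simp
  also have "\<dots> = Max ((\<lambda>x. real m * x) ` ((\<lambda>i. \<bar>?v i\<bar>) ` {..<n 0}))"
    by (simp add: image_image)
  also have "\<dots> = real m * Max ((\<lambda>i. \<bar>?v i\<bar>) ` {..<n 0})"
    using n0 by (intro mono_Max_commute[symmetric]) (auto simp: mono_def mult_left_mono lessThan_empty_iff)
  finally show ?thesis using m by (simp add: normalized_ones_norm_def)
qed

section \<open>Passing from one factor to the next\<close>

lemma iter_rows_indep:
  assumes M: "prob_space M" and A: "indep_random_mats M (\<lambda>q. n (q - 1)) n {1..p} A"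
    and k: "k < p"
  defines "D \<equiv> \<lambda>q. {..<n (q - 1)} \<times> {..<n q}"
  defines "Y \<equiv> \<lambda>\<omega>. \<lambda>q\<in>{p - k}. \<lambda>ij\<in>D q. A q \<omega> $$ ij"
    and "Z \<equiv> \<lambda>\<omega>. \<lambda>q\<in>{p - k<..p}. \<lambda>ij\<in>D q. A q \<omega> $$ ij"
    and "S \<equiv> \<lambda>I. PiM I (\<lambda>q. real_array (n (q - 1)) (n q))"
    and "g \<equiv> \<lambda>a. \<lambda>i\<in>{..<n (p - k)}. iter_rows p n a k i"
  shows "prob_space.indep_var M (S {p - k}) Y (S {p - k<..p}) Z"
    and "(\<lambda>y. y (p - k)) \<in> measurable (S {p - k}) (real_array (n (p - Suc k)) (n (p - k)))"
    and "g \<in> measurable (S {p - k<..p}) (real_vec (n (p - k)))"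
    and "Y \<omega> (p - k) = (\<lambda>ij\<in>{..<n (p - Suc k)} \<times> {..<n (p - k)}. A (p - k) \<omega> $$ ij)"
    and "g (Z \<omega>) = (\<lambda>i\<in>{..<n (p - k)}. iter_rows p n (\<lambda>q ij. A q \<omega> $$ ij) k i)"
proof -
  interpret prob_space M by fact
  \<comment> \<open>The blocks \<open>{p - k}\<close> and \<open>{p - k<..p}\<close> of the
    independent family of factors are disjoint.\<close>
  show "indep_var (S {p - k}) Y (S {p - k<..p}) Z"
    unfolding Y_def Z_def S_def D_def
    by (rule indep_var_restrict[OF A[unfolded indep_random_mats_def]]) (use k in auto)
  have "(\<lambda>y. y (p - k)) \<in> measurable (S {p - k}) (real_array (n (p - k - 1)) (n (p - k)))"
    unfolding S_def by (rule measurable_component_singleton) simp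
  then show "(\<lambda>y. y (p - k)) \<in> measurable (S {p - k}) (real_array (n (p - Suc k)) (n (p - k)))"
    by simp
  show "g \<in> measurable (S {p - k<..p}) (real_vec (n (p - k)))"
    unfolding g_def S_def by (intro measurable_restrict iter_rows_measurable) (use k in auto)
  show "Y \<omega> (p - k) = (\<lambda>ij\<in>{..<n (p - Suc k)} \<times> {..<n (p - k)}. A (p - k) \<omega> $$ ij)"
    by (simp add: Y_def D_def)
  show "g (Z \<omega>) = (\<lambda>i\<in>{..<n (p - k)}. iter_rows p n (\<lambda>q ij. A q \<omega> $$ ij) k i)"
    unfolding g_def
  proof (intro restrict_ext iter_rows_cong)
    fix q i j assume "q \<in> {p - k<..p}" "i < n (q - 1)" "j < n q"
    then show "Z \<omega> q (i, j) = A q \<omega> $$ (i, j)" by (simp add: Z_def D_def)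
  qed (use k in auto)
qed

text \<open>Conditions on the vector formed by the last \<open>k\<close> factors. With a target
  \<open>F\<close> of balanced vectors it drives the induction over the factors; with a target
  prescribing the largest entry it treats the leftmost one.\<close>

lemma iter_rows_prob_step:
  assumes M: "prob_space M" and A: "indep_random_mats M (\<lambda>q. n (q - 1)) n {1..p} A"
    and sm: "standard_matrix M (\<lambda>ij \<omega>. A (p - k) \<omega> $$ ij) (n (p - Suc k)) (n (p - k)) \<kappa>"
    and k: "k < p"
    and F: "F \<in> sets (real_vec (n (p - Suc k)))" and G: "G \<in> sets (real_vec (n (p - k)))"
    and d1: "0 \<le> d1" "\<And>v. v \<in> G \<Longrightarrow> measure M {\<omega> \<in> space M. (\<lambda>i\<in>{..<n (p - Suc k)}.
      standard_matrix.row_form (\<lambda>ij \<omega>. A (p - k) \<omega> $$ ij) (n (p - k)) v i \<omega>) \<notin> F} \<le> d1"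
    and d2: "measure M {\<omega> \<in> space M. (\<lambda>i\<in>{..<n (p - k)}. iter_rows p n (\<lambda>q ij. A q \<omega> $$ ij) k i) \<notin> G} \<le> d2"
  shows "measure M {\<omega> \<in> space M. (\<lambda>i\<in>{..<n (p - Suc k)}. iter_rows p n (\<lambda>q ij. A q \<omega> $$ ij) (Suc k) i) \<notin> F} \<le> d1 + d2"
proof -
  interpret standard_matrix M "\<lambda>ij \<omega>. A (p - k) \<omega> $$ ij" "n (p - Suc k)" "n (p - k)" \<kappa> by fact
  note I = iter_rows_indep[OF M A k]
  let ?g = "\<lambda>a. \<lambda>i\<in>{..<n (p - k)}. iter_rows p n a k i"
  let ?Z = "\<lambda>\<omega>. \<lambda>q\<in>{p - k<..p}. \<lambda>ij\<in>{..<n (q - 1)} \<times> {..<n q}. A q \<omega> $$ ij"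
  have "prob {\<omega> \<in> space M. (\<lambda>i\<in>{..<n (p - Suc k)}. row_form (?g (?Z \<omega>)) i \<omega>) \<notin> F} \<le> d1 + d2"
  proof (rule random_row_forms_prob_le[OF I(1,2,3) _ F G d1], rule I(4))
    show "prob {\<omega> \<in> space M. ?g (?Z \<omega>) \<notin> G} \<le> d2" unfolding I(5) by (rule d2)
  qed
  then have "measure M {\<omega> \<in> space M. (\<lambda>i\<in>{..<n (p - Suc k)}.
     row_form (\<lambda>i\<in>{..<n (p - k)}. iter_rows p n (\<lambda>q ij. A q \<omega> $$ ij) k i) i \<omega>) \<notin> F} \<le> d1 + d2"
    unfolding I(5) .
  moreover have "(\<lambda>i\<in>{..<n (p - Suc k)}. row_form (\<lambda>i\<in>{..<n (p - k)}. iter_rows p n (\<lambda>q ij. A q \<omega> $$ ij) k i) i \<omega>)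
     = (\<lambda>i\<in>{..<n (p - Suc k)}. iter_rows p n (\<lambda>q ij. A q \<omega> $$ ij) (Suc k) i)" for \<omega>
    by (auto simp: row_form_def fun_eq_iff restrict_def)
  ultimately show ?thesis by simp
qed

text \<open>Each factor triples the relative error and adds a failure probability, so the induction
  hypothesis is used at \<open>e / 3\<close> and \<open>\<eta> / 2\<close>. The product starts at
  \<open>q = p - k\<close> because there are \<open>n (p - k)\<close> entries, each with second
  moment equal to the product of the later dimensions. The bound \<open>k < p\<close> keeps the
  leftmost factor aside.\<close>

lemma iter_rows_balanced:
  fixes M :: "(nat \<Rightarrow> nat) \<Rightarrow> 'a measure"
  assumes M: "\<And>n. n \<in> dim_tuples p \<Longrightarrow> prob_space (M n)"
    and A: "\<And>n. n \<in> dim_tuples p \<Longrightarrow> indep_random_mats (M n) (\<lambda>q. n (q - 1)) n {1..p} (A n)"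
    and sm: "\<And>n q. n \<in> dim_tuples p \<Longrightarrow> q \<in> {1..p} \<Longrightarrow>
      standard_matrix (M n) (\<lambda>ij \<omega>. A n q \<omega> $$ ij) (n (q - 1)) (n q) \<kappa>"
    and \<kappa>: "0 \<le> \<kappa>" and k: "k < p" and e: "0 < e" "e \<le> 1" and \<eta>: "0 < \<eta>"
  shows "\<exists>N0 K. 0 < K \<and> (\<forall>n\<in>dim_tuples p. (\<forall>q\<in>{0..p}. N0 \<le> n q) \<longrightarrow>
     measure (M n) {\<omega> \<in> space (M n). (\<lambda>i\<in>{..<n (p - k)}. iter_rows p n (\<lambda>q ij. A n q \<omega> $$ ij) k i)
       \<notin> balanced_vecs (n (p - k)) (\<Prod>q=p-k..p. real (n q)) e K} \<le> \<eta>)"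
  using k e \<eta>
proof (induction k arbitrary: e \<eta>)
  case 0
  \<comment> \<open>For the vector of ones, both the squared norm and the sum of fourth powers equal
    \<open>n p\<close>, so there is no error; \<open>K = 2\<close> meets the strict
    inequality.\<close>
  have E: "{\<omega> \<in> space (M n). (\<lambda>i\<in>{..<n (p - 0)}. iter_rows p n (\<lambda>q ij. A n q \<omega> $$ ij) 0 i)
       \<notin> balanced_vecs (n (p - 0)) (\<Prod>q=p-0..p. real (n q)) e 2} = {}" if "n \<in> dim_tuples p" for n
  proof -
    have "n p \<in> {1..}" using that unfolding dim_tuples_def by (rule PiE_mem) simp
    then have "0 < real (n p)" by simp
    then have "(\<lambda>i\<in>{..<n p}. 1) \<in> balanced_vecs (n p) (real (n p)) e 2"
      using 0 by (simp add: balanced_vecs_def space_PiM power2_eq_square)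
    then show ?thesis by simp
  qed
  show ?case
  proof (intro exI[of _ "0 :: nat"] exI[of _ "2 :: real"] conjI ballI impI)
    fix n assume "n \<in> dim_tuples p"
    from E[OF this] show "measure (M n) {\<omega> \<in> space (M n).
       (\<lambda>i\<in>{..<n (p - 0)}. iter_rows p n (\<lambda>q ij. A n q \<omega> $$ ij) 0 i)
       \<notin> balanced_vecs (n (p - 0)) (\<Prod>q=p-0..p. real (n q)) e 2} \<le> \<eta>"
      using 0 by (simp only: measure_empty less_imp_le)
  qed simp
next
  case (Suc k)
  have "\<exists>N0 K. 0 < K \<and> (\<forall>n\<in>dim_tuples p. (\<forall>q\<in>{0..p}. N0 \<le> n q) \<longrightarrow>
     measure (M n) {\<omega> \<in> space (M n). (\<lambda>i\<in>{..<n (p - k)}. iter_rows p n (\<lambda>q ij. A n q \<omega> $$ ij) k i)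
       \<notin> balanced_vecs (n (p - k)) (\<Prod>q=p-k..p. real (n q)) (e / 3) K} \<le> \<eta> / 2)"
    by (rule Suc.IH) (use Suc.prems in simp_all)
  then obtain N1 K1 where IH: "\<And>n. n \<in> dim_tuples p \<Longrightarrow> (\<forall>q\<in>{0..p}. N1 \<le> n q) \<Longrightarrow>
     measure (M n) {\<omega> \<in> space (M n). (\<lambda>i\<in>{..<n (p - k)}. iter_rows p n (\<lambda>q ij. A n q \<omega> $$ ij) k i)
       \<notin> balanced_vecs (n (p - k)) (\<Prod>q=p-k..p. real (n q)) (e / 3) K1} \<le> \<eta> / 2"
    by blast
  \<comment> \<open>\<open>K\<close> and \<open>R\<close> make the Markov and the Chebyshev term
    equal to \<open>\<eta> / 4\<close> each, the latter at \<open>r = R\<close>.\<close>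
  define K where "K = 4 * (3 + \<kappa>) / \<eta>"
  define R where "R = 4 * (3 + \<kappa>) / (\<eta> * (e / 3)\<^sup>2)"
  have pos: "0 < K" "0 < R" using \<kappa> Suc.prems by (auto simp: K_def R_def)
  have KR: "3 + \<kappa> = K * (\<eta> / 4)" "3 + \<kappa> = R * (e / 3)\<^sup>2 * (\<eta> / 4)"
    using Suc.prems by (simp_all add: K_def R_def)
  show ?case
  proof (intro exI[of _ "max N1 (nat \<lceil>R\<rceil>)"] exI[of _ "4 * K"] conjI ballI impI)
    fix n assume n: "n \<in> dim_tuples p" and N: "\<forall>q\<in>{0..p}. max N1 (nat \<lceil>R\<rceil>) \<le> n q"
    have n1: "1 \<le> n q" if "q \<le> p" for q
    proof -
      have "n q \<in> {1..}" using n unfolding dim_tuples_def by (rule PiE_mem) (use that in simp)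
      then show ?thesis by simp
    qed
    let ?r = "n (p - Suc k)" and ?c = "n (p - k)" and ?N = "\<Prod>q=p-k..p. real (n q)"
    have pk: "p - k \<in> {1..p}" "p - k - 1 = p - Suc k" using Suc.prems by auto
    have sm': "standard_matrix (M n) (\<lambda>ij \<omega>. A n (p - k) \<omega> $$ ij) ?r ?c \<kappa>"
      using sm[OF n pk(1)] unfolding pk(2) .
    have Neq: "(\<Prod>q=p-Suc k..p. real (n q)) = real ?r * ?N"
    proof -
      have "{p - Suc k..p} = insert (p - Suc k) {p - k..p}" using Suc.prems by auto
      then show ?thesis by (simp only:) (subst prod.insert, use Suc.prems in auto)
    qed
    have N0: "0 < ?N" using n1 by (intro prod_pos) (auto simp: Suc_le_eq)
    have r1: "1 \<le> ?r" by (rule n1) simp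
    have "nat \<lceil>R\<rceil> \<le> ?r" using bspec[OF N, of "p - Suc k"] by simp
    then have rR: "R \<le> real ?r" by linarith
    have bound: "(3 + \<kappa>) / (real ?r * (e / 3)\<^sup>2) + (3 + \<kappa>) / K \<le> \<eta> / 2"
    proof -
      have "(3 + \<kappa>) / (real ?r * (e / 3)\<^sup>2) \<le> (3 + \<kappa>) / (R * (e / 3)\<^sup>2)"
        using rR pos Suc.prems \<kappa> by (intro divide_left_mono mult_right_mono mult_pos_pos) auto
      also have "\<dots> = \<eta> / 4" unfolding KR(2) using Suc.prems pos by simp
      finally have "(3 + \<kappa>) / (real ?r * (e / 3)\<^sup>2) \<le> \<eta> / 4" .
      moreover have "(3 + \<kappa>) / K = \<eta> / 4" unfolding KR(1) using pos by simp
      ultimately show ?thesis by linarith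
    qed
    have "measure (M n) {\<omega> \<in> space (M n). (\<lambda>i\<in>{..<?r}. iter_rows p n (\<lambda>q ij. A n q \<omega> $$ ij) (Suc k) i)
       \<notin> balanced_vecs ?r (real ?r * ?N) (3 * (e / 3)) (4 * K)} \<le> \<eta> / 2 + \<eta> / 2"
    proof (rule iter_rows_prob_step[OF M[OF n] A[OF n] sm' _ balanced_vecs_sets balanced_vecs_sets])
      show "k < p" using Suc.prems by simp
      show "0 \<le> \<eta> / 2" using Suc.prems by simp
      fix v assume v: "v \<in> balanced_vecs ?c ?N (e / 3) K1"
      show "measure (M n) {\<omega> \<in> space (M n). (\<lambda>i\<in>{..<?r}.
          standard_matrix.row_form (\<lambda>ij \<omega>. A n (p - k) \<omega> $$ ij) ?c v i \<omega>)
          \<notin> balanced_vecs ?r (real ?r * ?N) (3 * (e / 3)) (4 * K)} \<le> \<eta> / 2"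
        by (rule order_trans[OF standard_matrix.row_forms_balanced[OF sm' v N0 _ _ pos(1)] bound])
           (use Suc.prems r1 in auto)
    next
      show "measure (M n) {\<omega> \<in> space (M n). (\<lambda>i\<in>{..<?c}. iter_rows p n (\<lambda>q ij. A n q \<omega> $$ ij) k i)
          \<notin> balanced_vecs ?c ?N (e / 3) K1} \<le> \<eta> / 2"
        by (rule IH[OF n]) (use N in simp)
    qed
    then show "measure (M n) {\<omega> \<in> space (M n). (\<lambda>i\<in>{..<?r}. iter_rows p n (\<lambda>q ij. A n q \<omega> $$ ij) (Suc k) i)
       \<notin> balanced_vecs ?r (\<Prod>q=p-Suc k..p. real (n q)) e (4 * K)} \<le> \<eta>"
      unfolding Neq by simp
  qed (use pos in simp)
qed

lemma iid_random_mat_standard: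
  assumes M: "prob_space M" and \<nu>: "real_distribution \<nu>"
    and f: "integrable \<nu> (\<lambda>x. x ^ 4)" and c: "prob_space.expectation \<nu> (\<lambda>x. x) = 0"
    and v: "prob_space.variance \<nu> (\<lambda>x. x) = 1"
    and A: "iid_random_mat M \<nu> r s A" and \<kappa>: "prob_space.expectation \<nu> (\<lambda>x. x ^ 4) \<le> \<kappa>" "0 \<le> \<kappa>"
  shows "standard_matrix M (\<lambda>ij \<omega>. A \<omega> $$ ij) r s \<kappa>"
proof -
  interpret prob_space M by fact
  have d: "distr M borel (\<lambda>\<omega>. A \<omega> $$ (i, j)) = \<nu>" if "i < r" "j < s" for i j
    using A that by (auto simp: iid_random_mat_def)
  have ind: "indep_vars (\<lambda>_. borel) (\<lambda>ij \<omega>. A \<omega> $$ ij) ({..<r} \<times> {..<s})"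
    using A by (simp add: iid_random_mat_def)
  have m: "(\<lambda>\<omega>. A \<omega> $$ (i, j)) \<in> borel_measurable M" if "i < r" "j < s" for i j
    using ind that by (auto simp: indep_vars_def)
  have e: "expectation (\<lambda>\<omega>. (A \<omega> $$ (i, j)) ^ k) = (\<integral>x. x ^ k \<partial>\<nu>)" if "i < r" "j < s" for i j k
    using d[OF that] integral_distr[OF m[OF that], of "\<lambda>x. x ^ k"] by simp
  show ?thesis
  proof
    fix i j assume ij: "i < r" "j < s"
    show "integrable M (\<lambda>\<omega>. (A \<omega> $$ (i, j)) ^ 4)"
      using f d[OF ij] integrable_distr_eq[OF m[OF ij], of "\<lambda>x. x ^ 4"] by simp
    show "expectation (\<lambda>\<omega>. A \<omega> $$ (i, j)) = 0" using e[OF ij, of 1] c by simp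
    show "expectation (\<lambda>\<omega>. (A \<omega> $$ (i, j))\<^sup>2) = 1" using e[OF ij, of 2] v c by simp
    show "expectation (\<lambda>\<omega>. (A \<omega> $$ (i, j)) ^ 4) \<le> \<kappa>" using e[OF ij, of 4] \<kappa> by simp
  qed fact+
qed

lemma sup_between_normalized:
  assumes v: "(\<lambda>i\<in>{..<d}. v i) \<in> sup_between d ((1 - a) * sqrt L) ((1 + b) * sqrt L)"
    and d: "0 < d" and L: "0 < L" and ab: "a < e" "b < e"
  shows "\<bar>L powr (- 1 / 2) * Max ((\<lambda>i. \<bar>v i\<bar>) ` {..<d}) - 1\<bar> < e"
proof -
  let ?X = "Max ((\<lambda>i. \<bar>v i\<bar>) ` {..<d})"
  obtain i where i: "i < d" "(1 - a) * sqrt L \<le> \<bar>v i\<bar>" and ub: "\<And>i. i < d \<Longrightarrow> \<bar>v i\<bar> < (1 + b) * sqrt L"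
    using v by (auto simp: sup_between_def)
  have "\<bar>v i\<bar> \<le> ?X" using i(1) by (intro Max_ge) auto
  then have lo: "(1 - a) * sqrt L \<le> ?X" using i(2) by linarith
  have hi: "?X < (1 + b) * sqrt L" using ub d by (subst Max_less_iff) auto
  have eq: "L powr (- 1 / 2) * ?X = ?X / sqrt L"
    using powr_minus_divide[of L "1 / 2"] powr_half_sqrt[of L] L by simp
  have "1 - a \<le> ?X / sqrt L" "?X / sqrt L < 1 + b"
    using lo hi L by (simp_all add: pos_le_divide_eq pos_divide_less_eq)
  then show ?thesis unfolding eq using ab by linarith
qed

theorem theorem1p9:
  fixes p m :: nat
    and \<mu> :: "nat \<Rightarrow> real measure"
    and M :: "(nat \<Rightarrow> nat) \<Rightarrow> 'a measure"
    and A :: "(nat \<Rightarrow> nat) \<Rightarrow> nat \<Rightarrow> 'a \<Rightarrow> real mat"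
  assumes p: "p \<ge> 1" and m: "m \<ge> 1"
    and law: "\<And>q. q \<in> {1..p} \<Longrightarrow> real_distribution (\<mu> q)"
    and fourth_moment: "\<And>q. q \<in> {1..p} \<Longrightarrow> integrable (\<mu> q) (\<lambda>x. x ^ 4)"
    and centered: "\<And>q. q \<in> {1..p} \<Longrightarrow> prob_space.expectation (\<mu> q) (\<lambda>x. x) = 0"
    and unit_variance: "\<And>q. q \<in> {1..p} \<Longrightarrow> prob_space.variance (\<mu> q) (\<lambda>x. x) = 1"
    and space: "\<And>n. n \<in> dim_tuples p \<Longrightarrow> prob_space (M n)"
    and iid: "\<And>n q. n \<in> dim_tuples p \<Longrightarrow> q \<in> {1..p} \<Longrightarrow>
      iid_random_mat (M n) (\<mu> q) (n (q - 1)) (n q) (A n q)"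
    and indep: "\<And>n. n \<in> dim_tuples p \<Longrightarrow>
      indep_random_mats (M n) (\<lambda>q. n (q - 1)) n {1..p} (A n)"
  shows "tendsto_in_prob_asymp p M
           (\<lambda>n \<omega>. normalized_ones_norm p n m (\<lambda>q. A n q \<omega>)) (\<lambda>_. 1) \<and>
         (\<forall>n\<in>dim_tuples p. \<forall>\<omega>\<in>space (M n). \<forall>m'\<ge>1.
           normalized_ones_norm p n m' (\<lambda>q. A n q \<omega>) =
           normalized_ones_norm p n m (\<lambda>q. A n q \<omega>))"
proof -
  \<comment> \<open>Fourth moments are nonnegative, so their sum dominates each of them and gives
    one constant for all factors.\<close>
  define \<kappa> where "\<kappa> = (\<Sum>q\<in>{1..p}. prob_space.expectation (\<mu> q) (\<lambda>x. x ^ 4))"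
  have mom0: "0 \<le> prob_space.expectation (\<mu> q) (\<lambda>x. x ^ 4)" for q
    by (intro integral_nonneg_AE) auto
  have \<kappa>0: "0 \<le> \<kappa>" unfolding \<kappa>_def by (intro sum_nonneg mom0)
  have sm: "standard_matrix (M n) (\<lambda>ij \<omega>. A n q \<omega> $$ ij) (n (q - 1)) (n q) \<kappa>"
    if "n \<in> dim_tuples p" "q \<in> {1..p}" for n q
  proof (rule iid_random_mat_standard[OF space law fourth_moment centered unit_variance iid])
    show "prob_space.expectation (\<mu> q) (\<lambda>x. x ^ 4) \<le> \<kappa>"
      unfolding \<kappa>_def using that mom0 by (intro member_le_sum) auto
  qed (use that \<kappa>0 in auto)
  have n1: "1 \<le> n q" if "n \<in> dim_tuples p" "q \<le> p" for n q
  proof -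
    have "n q \<in> {1..}" using that(1) unfolding dim_tuples_def by (rule PiE_mem) (use that in simp)
    then show ?thesis by simp
  qed
  have eq: "normalized_ones_norm p n k (\<lambda>q. A n q \<omega>)
     = (2 * (\<Prod>q=1..p. real (n q)) * ln (real (n 0))) powr (- 1 / 2)
     * Max ((\<lambda>i. \<bar>iter_rows p n (\<lambda>q ij. A n q \<omega> $$ ij) p i\<bar>) ` {..<n 0})"
    if "n \<in> dim_tuples p" "\<omega> \<in> space (M n)" "1 \<le> k" for n \<omega> k
    using iid[OF that(1)] that n1[OF that(1), of 0]
    by (intro normalized_ones_norm_eq) (auto simp: iid_random_mat_def)
  have "\<exists>N. \<forall>n\<in>dim_tuples p.
           (\<forall>q\<in>{0..p}. \<forall>q'\<in>{0..p}. N \<le> n q \<and> real (n q) \<le> C * real (n q')) \<longrightarrow>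
           measure (M n) {\<omega> \<in> space (M n). \<bar>normalized_ones_norm p n m (\<lambda>q. A n q \<omega>) - 1\<bar> \<ge> \<epsilon>} \<le> \<eta>"
    if \<epsilon>: "0 < \<epsilon>" and \<eta>: "0 < \<eta>" for C \<epsilon> \<eta> :: real
  proof -
    \<comment> \<open>This reads \<open>(min \<epsilon> 1) / 8\<close>: it meets the bound 1/8
      required for the maximum and puts the margins \<open>4 * \<delta>\<close> and
      \<open>3 * \<delta>\<close> below \<open>\<epsilon>\<close>.\<close>
    define \<delta> where "\<delta> = min \<epsilon> 1 / 8"
    have \<delta>: "0 < \<delta>" "\<delta> \<le> 1 / 8" "\<delta> \<le> 1" "4 * \<delta> < \<epsilon>" "3 * \<delta> < \<epsilon>" using \<epsilon> by (auto simp: \<delta>_def)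
    have \<eta>2: "0 < \<eta> / 2" using \<eta> by simp
    \<comment> \<open>\<open>C\<close> is an arbitrary real; replacing it by \<open>max C 1\<close>
      provides the positivity needed for the maximum.\<close>
    have C: "0 < max C 1" by simp
    have pm: "p - (p - 1) = 1" "p - Suc (p - 1) = 0" "Suc (p - 1) = p" "p - p = 0" "p - 1 < p" using p by auto
    obtain N1 K where K: "0 < K" and N1: "\<And>n. n \<in> dim_tuples p \<Longrightarrow> (\<forall>q\<in>{0..p}. N1 \<le> n q) \<Longrightarrow>
     measure (M n) {\<omega> \<in> space (M n). (\<lambda>i\<in>{..<n 1}. iter_rows p n (\<lambda>q ij. A n q \<omega> $$ ij) (p - 1) i)
       \<notin> balanced_vecs (n 1) (\<Prod>q=1..p. real (n q)) \<delta> K} \<le> \<eta> / 2"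
      using iter_rows_balanced[OF space indep sm \<kappa>0 pm(5) \<delta>(1,3) \<eta>2] unfolding pm by blast
    obtain N2 where N2: "\<And>(M :: 'a measure) X r c v N. standard_matrix M X r c \<kappa> \<Longrightarrow> N2 \<le> r \<Longrightarrow> 0 < c \<Longrightarrow>
     real r \<le> max C 1 * real c \<Longrightarrow> 0 < N \<Longrightarrow> v \<in> balanced_vecs c N \<delta> K \<Longrightarrow>
     measure M {\<omega> \<in> space M. (\<lambda>i\<in>{..<r}. standard_matrix.row_form X c v i \<omega>)
        \<notin> sup_between r ((1 - 4 * \<delta>) * sqrt (2 * N * ln (real r))) ((1 + 3 * \<delta>) * sqrt (2 * N * ln (real r)))} \<le> \<eta> / 2"
      using max_row_form_asymp[OF K C \<delta>(1,2) \<eta>2, of \<kappa>, where 'a = 'a] by blast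
    show ?thesis
    \<comment> \<open>The 2 ensures \<open>ln (real (n 0)) > 0\<close>, hence a nonzero
      normalization.\<close>
    proof (intro exI[of _ "max (max N1 N2) 2"] ballI impI)
      fix n assume n: "n \<in> dim_tuples p"
        and N: "\<forall>q\<in>{0..p}. \<forall>q'\<in>{0..p}. max (max N1 N2) 2 \<le> n q \<and> real (n q) \<le> C * real (n q')"
      interpret prob_space "M n" by (rule space[OF n])
      let ?N = "\<Prod>q=1..p. real (n q)"
      let ?u = "\<lambda>\<omega>. \<lambda>i\<in>{..<n 0}. iter_rows p n (\<lambda>q ij. A n q \<omega> $$ ij) p i"
      let ?F = "sup_between (n 0) ((1 - 4 * \<delta>) * sqrt (2 * ?N * ln (real (n 0)))) ((1 + 3 * \<delta>) * sqrt (2 * ?N * ln (real (n 0))))"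
      have Npos: "0 < ?N" using n1[OF n] by (intro prod_pos) (auto simp: Suc_le_eq)
      have n0: "max (max N1 N2) 2 \<le> n 0"
        using bspec[OF bspec[OF N, of 0], of 0] by simp
      then have ln0: "0 < ln (real (n 0))" by (intro ln_gt_zero) simp
      have C01: "real (n 0) \<le> max C 1 * real (n 1)"
      proof -
        have "real (n 0) \<le> C * real (n 1)"
          using bspec[OF bspec[OF N, of 0], of 1] p by simp
        also have "\<dots> \<le> max C 1 * real (n 1)" by (intro mult_right_mono) auto
        finally show ?thesis .
      qed
      have sm1: "standard_matrix (M n) (\<lambda>ij \<omega>. A n 1 \<omega> $$ ij) (n 0) (n 1) \<kappa>"
        using sm[OF n, of 1] p by simp
      have step: "prob {\<omega> \<in> space (M n). ?u \<omega> \<notin> ?F} \<le> \<eta> / 2 + \<eta> / 2"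
      \<comment> \<open>The last step, \<open>k = p - 1\<close>: the leftmost factor acts on a
        vector that is balanced up to probability \<open>\<eta> / 2\<close>, and at such a vector
        the maximum misses its window with probability at most \<open>\<eta> / 2\<close>.\<close>
      proof (rule iter_rows_prob_step[OF space[OF n] indep[OF n], of "p - 1", unfolded pm,
            OF sm1 _ sup_between_sets balanced_vecs_sets])
        show "p - 1 < p" "0 \<le> \<eta> / 2" using p \<eta> by simp_all
        fix v assume v: "v \<in> balanced_vecs (n 1) ?N \<delta> K"
        show "prob {\<omega> \<in> space (M n). (\<lambda>i\<in>{..<n 0}.
          standard_matrix.row_form (\<lambda>ij \<omega>. A n 1 \<omega> $$ ij) (n 1) v i \<omega>) \<notin> ?F} \<le> \<eta> / 2"
          by (rule N2[OF sm1 _ _ C01 Npos v]) (use n0 n1[OF n p] in simp_all)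
      next
        show "prob {\<omega> \<in> space (M n). (\<lambda>i\<in>{..<n 1}. iter_rows p n (\<lambda>q ij. A n q \<omega> $$ ij) (p - 1) i)
           \<notin> balanced_vecs (n 1) ?N \<delta> K} \<le> \<eta> / 2"
          by (rule N1[OF n]) (use N in simp)
      qed
      \<comment> \<open>Monotonicity of the measure asks for measurability of the larger event,
        which is a preimage under the whole vector of row sums.\<close>
      have um: "?u \<in> measurable (M n) (real_vec (n 0))"
      proof (intro measurable_restrict iter_rows_borel_measurable)
        fix q i j assume "q \<in> {1..p}" "i < n (q - 1)" "j < n q"
        then show "(\<lambda>\<omega>. A n q \<omega> $$ (i, j)) \<in> borel_measurable (M n)"
          by (rule standard_matrix.entry_measurable[OF sm[OF n]])
      qed auto
      have "{\<omega> \<in> space (M n). \<epsilon> \<le> \<bar>normalized_ones_norm p n m (\<lambda>q. A n q \<omega>) - 1\<bar>}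
         \<subseteq> {\<omega> \<in> space (M n). ?u \<omega> \<notin> ?F}"
      proof (rule subsetI, rule ccontr)
        fix \<omega> assume a: "\<omega> \<in> {\<omega> \<in> space (M n). \<epsilon> \<le> \<bar>normalized_ones_norm p n m (\<lambda>q. A n q \<omega>) - 1\<bar>}"
          and "\<omega> \<notin> {\<omega> \<in> space (M n). ?u \<omega> \<notin> ?F}"
        then have w: "\<omega> \<in> space (M n)" "?u \<omega> \<in> ?F" by blast+
        have L: "0 < 2 * ?N * ln (real (n 0))" using Npos ln0 by simp
        have "0 < n 0" using n0 by simp
        then have "\<bar>normalized_ones_norm p n m (\<lambda>q. A n q \<omega>) - 1\<bar> < \<epsilon>"
          unfolding eq[OF n w(1) m] by (rule sup_between_normalized[OF w(2) _ L \<delta>(4,5)])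
        then show False using a by simp
      qed
      moreover have "{\<omega> \<in> space (M n). ?u \<omega> \<notin> ?F} \<in> events"
      proof -
        have "{\<omega> \<in> space (M n). ?u \<omega> \<notin> ?F} = space (M n) - (?u -` ?F \<inter> space (M n))" by auto
        then show ?thesis using measurable_sets[OF um sup_between_sets] by auto
      qed
      ultimately have "prob {\<omega> \<in> space (M n). \<epsilon> \<le> \<bar>normalized_ones_norm p n m (\<lambda>q. A n q \<omega>) - 1\<bar>}
        \<le> prob {\<omega> \<in> space (M n). ?u \<omega> \<notin> ?F}"
        by (rule finite_measure_mono)
      also have "\<dots> \<le> \<eta>" using step by simp
      finally show "prob {\<omega> \<in> space (M n). \<epsilon> \<le> \<bar>normalized_ones_norm p n m (\<lambda>q. A n q \<omega>) - 1\<bar>} \<le> \<eta>" .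
    qed
  qed
  then have "tendsto_in_prob_asymp p M (\<lambda>n \<omega>. normalized_ones_norm p n m (\<lambda>q. A n q \<omega>)) (\<lambda>_. 1)"
    unfolding tendsto_in_prob_asymp_def by blast
  \<comment> \<open>Both sides reduce to the same expression, in which the number of columns no
    longer occurs.\<close>
  moreover have "normalized_ones_norm p n m' (\<lambda>q. A n q \<omega>) = normalized_ones_norm p n m (\<lambda>q. A n q \<omega>)"
    if "n \<in> dim_tuples p" "\<omega> \<in> space (M n)" "1 \<le> m'" for n \<omega> m'
    unfolding eq[OF that] eq[OF that(1,2) m] ..
  ultimately show ?thesis by blast
qed

end
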